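(* Let $(U,\curvearrowright)$ be a Lie $\mathfrak{h}$-module and $(V,\cdot)$ an $\mathcal{A}$-module, where $\mathcal{A}=\mathcal{A}(\mathfrak{h},\mathfrak{g})$. Then: 1) There is a functor $U\otimes -\colon {}_{\mathcal{A}}\mathcal{M}\to {}_{\mathfrak{g}}\mathcal{L}\mathcal{M}$ from the category of $\mathcal{A}$-modules to the category of Lie $\mathfrak{g}$-modules, sending an $\mathcal{A}$-module $X$ to $U\otimes X$ and an $\mathcal{A}$-module morphism $g$ to $\mathrm{Id}_U\otimes g$. 2) There is a functor $-\otimes V\colon {}_{\mathfrak{h}}\mathcal{L}\mathcal{M}\to {}_{\mathfrak{g}}\mathcal{L}\mathcal{M}$ between the categories of Lie modules over $\mathfrak{h}$ and $\mathfrak{g}$ respectively, sending a Lie $\mathfrak{h}$-module $Y$ to $Y\otimes V$ and a Lie $\mathfrak{h}$-module morphism $g$ to $g\otimes\mathrm{Id}_V$. Here, for any Lie $\mathfrak{h}$-module $(Y,\curvearrowright)$ and any $\mathcal{A}$-module $(X,\cdot)$, the tensor product $Y\otimes X$ carries the $\mathfrak{g}$-action $f_i\rightharpoonup(l\otimes t)=\sum_{j=1}^n (e_j\curvearrowright l)\otimes(x_{ji}\cdot t)$ for all $i\in I$, $l\in Y$, $t\in X$.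
   Context: Everything is over an arbitrary field $k$, and $\otimes = \otimes_k$; associative algebras are unital. $\mathfrak{g}$ and $\mathfrak{h}$ are Lie algebras, with $\mathfrak{h}$ finite dimensional ($\mathfrak{g}$ is arbitrary). Fix a basis $\{f_i \mid i \in I\}$ of $\mathfrak{g}$ and a basis $\{e_1, \dots, e_n\}$ of $\mathfrak{h}$, with structure constants given by $[e_i, e_j]_{\mathfrak{h}} = \sum_{s=1}^n \tau_{i,j}^s e_s$ for $i,j=1,\dots,n$, and $[f_i, f_j]_{\mathfrak{g}} = \sum_{u \in B_{i,j}} \beta_{i,j}^u f_u$ for $i,j\in I$, where $B_{i,j}\subseteq I$ is a finite subset and $\tau_{i,j}^s,\beta_{i,j}^u \in k$. A (left) Lie $\mathfrak{g}$-module is a vector space $V$ with a bilinear map $\rightharpoonup\colon \mathfrak{g}\times V \to V$ such that $[x,y]\rightharpoonup v = x\rightharpoonup(y\rightharpoonup v) - y\rightharpoonup (x\rightharpoonup v)$ for all $x,y\in\mathfrak{g}$, $v\in V$ (similarly for $\mathfrak{h}$). The universal algebra of $\mathfrak{h}$ and $\mathfrak{g}$ is the commutative algebra $\mathcal{A}=\mathcal{A}(\mathfrak{h},\mathfrak{g}) := k[X_{si} \mid s=1,\dots,n,\ i\in I]/\mathcal{J}$, where $\mathcal{J}$ is the ideal generated by all polynomials $\sum_{u\in B_{i,j}} \beta_{i,j}^u X_{au} - \sum_{s,t=1}^n \tau_{s,t}^a X_{si}X_{tj}$, for $a=1,\dots,n$ and $i,j\in I$. The class of $X_{si}$ in $\mathcal{A}$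 is denoted $x_{si}$. ${}_{\mathcal{A}}\mathcal{M}$ denotes the category of left $\mathcal{A}$-modules and ${}_{\mathfrak{g}}\mathcal{L}\mathcal{M}$, ${}_{\mathfrak{h}}\mathcal{L}\mathcal{M}$ the categories of left Lie $\mathfrak{g}$-modules and left Lie $\mathfrak{h}$-modules. *)

theory Defs
  imports
    "HOL-Algebra.Algebraic_Closure_Type"
    "HOL-Algebra.QuotRing"
    "HOL-Algebra.Module"
    "HOL-Library.Poly_Mapping"
    "HOL-Library.FuncSet"
begin

text \<open>
  The base field is a type \<open>'k::field\<close>, seen as a ring record through
  \<^const>\<open>ring_of_type_algebra\<close>; vector spaces are modules over it, with a carrier set.
  The record type \<^typ>\<open>('a, 'b) module\<close> inherits from rings the fields \<open>mult\<close> and \<open>one\<close>,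
  which have no meaning for a module and are ignored throughout.
\<close>

section \<open>Categories and functors\<close>

text \<open>
  Morphisms come in families \<open>Hom Q R\<close>, and composition and identities are indexed by
  objects: for structures with a carrier, a morphism is a function on the carrier of its
  source (undefined elsewhere), so that source has to be known in order to compose.
\<close>

record ('o, 'm) category =
  Obj :: "'o set"
  Hom :: "'o \<Rightarrow> 'o \<Rightarrow> 'm set"
  Ident :: "'o \<Rightarrow> 'm"
  Comp :: "'o \<Rightarrow> 'o \<Rightarrow> 'o \<Rightarrow> 'm \<Rightarrow> 'm \<Rightarrow> 'm"
    \<comment> \<open>\<open>Comp Q R S \<psi> \<phi>\<close> is \<open>\<psi>\<close> after \<open>\<phi>\<close>, for \<open>\<phi> : Q \<rightarrow> R\<close> and \<open>\<psi> : R \<rightarrow> S\<close>\<close>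

locale category =
  fixes C :: "('o, 'm) category"
  assumes Ident_in_Hom: "Q \<in> Obj C \<Longrightarrow> Ident C Q \<in> Hom C Q Q"
    and Comp_in_Hom:
      "\<lbrakk>Q \<in> Obj C; R \<in> Obj C; S \<in> Obj C; \<phi> \<in> Hom C Q R; \<psi> \<in> Hom C R S\<rbrakk>
        \<Longrightarrow> Comp C Q R S \<psi> \<phi> \<in> Hom C Q S"
    and Comp_Ident_left:
      "\<lbrakk>Q \<in> Obj C; R \<in> Obj C; \<phi> \<in> Hom C Q R\<rbrakk> \<Longrightarrow> Comp C Q R R (Ident C R) \<phi> = \<phi>"
    and Comp_Ident_right:
      "\<lbrakk>Q \<in> Obj C; R \<in> Obj C; \<phi> \<in> Hom C Q R\<rbrakk> \<Longrightarrow> Comp C Q Q R \<phi> (Ident C Q) = \<phi>"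
    and Comp_assoc:
      "\<lbrakk>P \<in> Obj C; Q \<in> Obj C; R \<in> Obj C; S \<in> Obj C;
        \<phi> \<in> Hom C P Q; \<psi> \<in> Hom C Q R; \<chi> \<in> Hom C R S\<rbrakk>
        \<Longrightarrow> Comp C P R S \<chi> (Comp C P Q R \<psi> \<phi>) = Comp C P Q S (Comp C Q R S \<chi> \<psi>) \<phi>"

locale category_functor = C: category C + D: category D
  for C :: "('o1, 'm1) category" and D :: "('o2, 'm2) category" +
  fixes F_obj :: "'o1 \<Rightarrow> 'o2"
    and F_hom :: "'o1 \<Rightarrow> 'o1 \<Rightarrow> 'm1 \<Rightarrow> 'm2"
  assumes F_obj_in_Obj: "Q \<in> Obj C \<Longrightarrow> F_obj Q \<in> Obj D"
    and F_hom_in_Hom: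
      "\<lbrakk>Q \<in> Obj C; R \<in> Obj C; \<phi> \<in> Hom C Q R\<rbrakk> \<Longrightarrow> F_hom Q R \<phi> \<in> Hom D (F_obj Q) (F_obj R)"
    and F_hom_Ident: "Q \<in> Obj C \<Longrightarrow> F_hom Q Q (Ident C Q) = Ident D (F_obj Q)"
    and F_hom_Comp:
      "\<lbrakk>Q \<in> Obj C; R \<in> Obj C; S \<in> Obj C; \<phi> \<in> Hom C Q R; \<psi> \<in> Hom C R S\<rbrakk>
        \<Longrightarrow> F_hom Q S (Comp C Q R S \<psi> \<phi>)
            = Comp D (F_obj Q) (F_obj R) (F_obj S) (F_hom R S \<psi>) (F_hom Q R \<phi>)"

section \<open>Modules\<close>

definition linear_maps ::
    "('a, 'r) ring_scheme \<Rightarrow> ('a, 'b, 'p) module_scheme \<Rightarrow> ('a, 'c, 'q) module_scheme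
      \<Rightarrow> ('b \<Rightarrow> 'c) set"
  where "linear_maps R M N =
    {\<phi> \<in> carrier M \<rightarrow>\<^sub>E carrier N.
      (\<forall>x\<in>carrier M. \<forall>y\<in>carrier M. \<phi> (x \<oplus>\<^bsub>M\<^esub> y) = \<phi> x \<oplus>\<^bsub>N\<^esub> \<phi> y) \<and>
      (\<forall>a\<in>carrier R. \<forall>x\<in>carrier M. \<phi> (a \<odot>\<^bsub>M\<^esub> x) = a \<odot>\<^bsub>N\<^esub> \<phi> x)}"

definition module_category ::
    "('a, 'r) ring_scheme \<Rightarrow> (('a, 'b) module, 'b \<Rightarrow> 'b) category"
  where "module_category R =
    \<lparr>Obj = {M. module R M},
     Hom = linear_maps R,
     Ident = (\<lambda>M. \<lambda>x\<in>carrier M. x),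
     Comp = (\<lambda>L M N \<psi> \<phi>. compose (carrier L) \<psi> \<phi>)\<rparr>"

definition submodule_generated ::
    "('a, 'r) ring_scheme \<Rightarrow> ('a, 'b, 'p) module_scheme \<Rightarrow> 'b set \<Rightarrow> 'b set"
  where "submodule_generated R M S = \<Inter>{H. submodule H R M \<and> S \<subseteq> H}"

definition quotient_module ::
    "('a, 'b, 'p) module_scheme \<Rightarrow> 'b set \<Rightarrow> ('a, 'b set) module"
  where "quotient_module M H =
    \<lparr>carrier = a_rcosets\<^bsub>M\<^esub> H, monoid.mult = undefined, one = undefined,
     ring.zero = H, add = set_add M,
     module.smult = (\<lambda>a C. \<Union>x\<in>C. H +>\<^bsub>M\<^esub> (a \<odot>\<^bsub>M\<^esub> x))\<rparr>"

text \<open>A linear combination of the family \<open>b\<close> is given by its finitely supported coefficients.\<close>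

definition linear_combination ::
    "('k::field, 'b, 'p) module_scheme \<Rightarrow> ('i \<Rightarrow> 'b) \<Rightarrow> ('i \<Rightarrow>\<^sub>0 'k) \<Rightarrow> 'b"
  where "linear_combination M b c =
    (\<Oplus>\<^bsub>M\<^esub>i\<in>Poly_Mapping.keys c. Poly_Mapping.lookup c i \<odot>\<^bsub>M\<^esub> b i)"

definition is_basis ::
    "('k::field, 'b, 'p) module_scheme \<Rightarrow> 'i set \<Rightarrow> ('i \<Rightarrow> 'b) \<Rightarrow> bool"
  where "is_basis M J b \<longleftrightarrow>
    b \<in> J \<rightarrow> carrier M \<and>
    (\<forall>c. Poly_Mapping.keys c \<subseteq> J \<and> linear_combination M b c = \<zero>\<^bsub>M\<^esub> \<longrightarrow> c = 0) \<and>
    (\<forall>v\<in>carrier M. \<exists>c. Poly_Mapping.keys c \<subseteq> J \<and> linear_combination M b c = v)"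

definition coordinates ::
    "('k::field, 'b, 'p) module_scheme \<Rightarrow> 'i set \<Rightarrow> ('i \<Rightarrow> 'b) \<Rightarrow> 'b \<Rightarrow> ('i \<Rightarrow>\<^sub>0 'k)"
  where "coordinates M J b v =
    (THE c. Poly_Mapping.keys c \<subseteq> J \<and> linear_combination M b c = v)"

section \<open>Tensor products over the base field\<close>

definition free_module :: "'b set \<Rightarrow> ('k::field, 'b \<Rightarrow>\<^sub>0 'k) module"
  where "free_module B =
    \<lparr>carrier = {c. Poly_Mapping.keys c \<subseteq> B}, monoid.mult = undefined, one = undefined,
     ring.zero = 0, add = (+),
     module.smult = (\<lambda>a. Poly_Mapping.map ((*) a))\<rparr>"

definition tensor_relations ::
    "('k::field, 'b, 'p) module_scheme \<Rightarrow> ('k, 'c, 'q) module_scheme \<Rightarrow> ('b \<times> 'c \<Rightarrow>\<^sub>0 'k) set"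
  where "tensor_relations M N = submodule_generated ring_of_type_algebra
    (free_module (carrier M \<times> carrier N))
    ({Poly_Mapping.single (x \<oplus>\<^bsub>M\<^esub> x', y) 1
        - Poly_Mapping.single (x, y) 1 - Poly_Mapping.single (x', y) 1 |
        x x' y. x \<in> carrier M \<and> x' \<in> carrier M \<and> y \<in> carrier N} \<union>
     {Poly_Mapping.single (x, y \<oplus>\<^bsub>N\<^esub> y') 1
        - Poly_Mapping.single (x, y) 1 - Poly_Mapping.single (x, y') 1 |
        x y y'. x \<in> carrier M \<and> y \<in> carrier N \<and> y' \<in> carrier N} \<union>
     {Poly_Mapping.single (a \<odot>\<^bsub>M\<^esub> x, y) 1 - Poly_Mapping.single (x, y) a |
        a x y. x \<in> carrier M \<and> y \<in> carrier N} \<union>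
     {Poly_Mapping.single (x, a \<odot>\<^bsub>N\<^esub> y) 1 - Poly_Mapping.single (x, y) a |
        a x y. x \<in> carrier M \<and> y \<in> carrier N})"

definition tensor_product ::
    "('k::field, 'b, 'p) module_scheme \<Rightarrow> ('k, 'c, 'q) module_scheme
      \<Rightarrow> ('k, ('b \<times> 'c \<Rightarrow>\<^sub>0 'k) set) module"
  where "tensor_product M N =
    quotient_module (free_module (carrier M \<times> carrier N)) (tensor_relations M N)"

definition pure_tensor ::
    "('k::field, 'b, 'p) module_scheme \<Rightarrow> ('k, 'c, 'q) module_scheme
      \<Rightarrow> 'b \<Rightarrow> 'c \<Rightarrow> ('b \<times> 'c \<Rightarrow>\<^sub>0 'k) set"
  where "pure_tensor M N x y =
    tensor_relations M N
      +>\<^bsub>(free_module (carrier M \<times> carrier N) :: ('k, 'b \<times> 'c \<Rightarrow>\<^sub>0 'k) module)\<^esub>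
      Poly_Mapping.single (x, y) 1"

text \<open>The map \<open>\<phi> \<otimes> \<psi>\<close> for linear maps \<open>\<phi> : M \<rightarrow> M'\<close> and \<open>\<psi> : N \<rightarrow> N'\<close>: extend
  \<open>(x, y) \<mapsto> (\<phi> x, \<psi> y)\<close> linearly to the free modules and pass to the quotients.\<close>

definition tensor_map ::
    "('k::field, 'b, 'p) module_scheme \<Rightarrow> ('k, 'c, 'q) module_scheme
      \<Rightarrow> ('k, 'd, 'r) module_scheme \<Rightarrow> ('k, 'e, 's) module_scheme
      \<Rightarrow> ('b \<Rightarrow> 'd) \<Rightarrow> ('c \<Rightarrow> 'e) \<Rightarrow> ('b \<times> 'c \<Rightarrow>\<^sub>0 'k) set \<Rightarrow> ('d \<times> 'e \<Rightarrow>\<^sub>0 'k) set"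
  where "tensor_map M N M' N' \<phi> \<psi> = (\<lambda>C\<in>carrier (tensor_product M N).
    \<Union>c\<in>C. tensor_relations M' N'
      +>\<^bsub>(free_module (carrier M' \<times> carrier N') :: ('k, 'd \<times> 'e \<Rightarrow>\<^sub>0 'k) module)\<^esub>
      (\<Sum>(x, y)\<in>Poly_Mapping.keys c.
        Poly_Mapping.single (\<phi> x, \<psi> y) (Poly_Mapping.lookup c (x, y))))"

section \<open>Lie algebras and Lie modules\<close>

record ('a, 'b) lie_algebra = "('a, 'b) module" +
  bracket :: "'b \<Rightarrow> 'b \<Rightarrow> 'b"

locale lie_algebra = K?: field K + L?: module K L
  for K :: "('a, 'r) ring_scheme" (structure) and L :: "('a, 'b, 'p) lie_algebra_scheme" (structure) +
  assumes bracket_closed: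
      "\<lbrakk>x \<in> carrier L; y \<in> carrier L\<rbrakk> \<Longrightarrow> bracket L x y \<in> carrier L"
    and bracket_add_left:
      "\<lbrakk>x \<in> carrier L; y \<in> carrier L; z \<in> carrier L\<rbrakk>
        \<Longrightarrow> bracket L (x \<oplus>\<^bsub>L\<^esub> y) z = bracket L x z \<oplus>\<^bsub>L\<^esub> bracket L y z"
    and bracket_add_right:
      "\<lbrakk>x \<in> carrier L; y \<in> carrier L; z \<in> carrier L\<rbrakk>
        \<Longrightarrow> bracket L x (y \<oplus>\<^bsub>L\<^esub> z) = bracket L x y \<oplus>\<^bsub>L\<^esub> bracket L x z"
    and bracket_smult_left:
      "\<lbrakk>a \<in> carrier K; x \<in> carrier L; y \<in> carrier L\<rbrakk>
        \<Longrightarrow> bracket L (a \<odot>\<^bsub>L\<^esub> x) y = a \<odot>\<^bsub>L\<^esub> bracket L x y"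
    and bracket_smult_right:
      "\<lbrakk>a \<in> carrier K; x \<in> carrier L; y \<in> carrier L\<rbrakk>
        \<Longrightarrow> bracket L x (a \<odot>\<^bsub>L\<^esub> y) = a \<odot>\<^bsub>L\<^esub> bracket L x y"
    and bracket_self: "x \<in> carrier L \<Longrightarrow> bracket L x x = \<zero>\<^bsub>L\<^esub>"
    and jacobi:
      "\<lbrakk>x \<in> carrier L; y \<in> carrier L; z \<in> carrier L\<rbrakk>
        \<Longrightarrow> bracket L x (bracket L y z) \<oplus>\<^bsub>L\<^esub> bracket L y (bracket L z x)
              \<oplus>\<^bsub>L\<^esub> bracket L z (bracket L x y) = \<zero>\<^bsub>L\<^esub>"

record ('a, 'l, 'b) lie_module = "('a, 'b) module" +
  act :: "'l \<Rightarrow> 'b \<Rightarrow> 'b"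

locale lie_module = L: lie_algebra K L + M: module K M
  for K :: "('a, 'r) ring_scheme" and L :: "('a, 'l, 'p) lie_algebra_scheme"
    and M :: "('a, 'l, 'b, 'q) lie_module_scheme" +
  assumes act_closed:
      "\<lbrakk>x \<in> carrier L; v \<in> carrier M\<rbrakk> \<Longrightarrow> act M x v \<in> carrier M"
    and act_add_left:
      "\<lbrakk>x \<in> carrier L; y \<in> carrier L; v \<in> carrier M\<rbrakk>
        \<Longrightarrow> act M (x \<oplus>\<^bsub>L\<^esub> y) v = act M x v \<oplus>\<^bsub>M\<^esub> act M y v"
    and act_add_right:
      "\<lbrakk>x \<in> carrier L; v \<in> carrier M; w \<in> carrier M\<rbrakk>
        \<Longrightarrow> act M x (v \<oplus>\<^bsub>M\<^esub> w) = act M x v \<oplus>\<^bsub>M\<^esub> act M x w"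
    and act_smult_left:
      "\<lbrakk>a \<in> carrier K; x \<in> carrier L; v \<in> carrier M\<rbrakk>
        \<Longrightarrow> act M (a \<odot>\<^bsub>L\<^esub> x) v = a \<odot>\<^bsub>M\<^esub> act M x v"
    and act_smult_right:
      "\<lbrakk>a \<in> carrier K; x \<in> carrier L; v \<in> carrier M\<rbrakk>
        \<Longrightarrow> act M x (a \<odot>\<^bsub>M\<^esub> v) = a \<odot>\<^bsub>M\<^esub> act M x v"
    and act_bracket:
      "\<lbrakk>x \<in> carrier L; y \<in> carrier L; v \<in> carrier M\<rbrakk>
        \<Longrightarrow> act M (bracket L x y) v = act M x (act M y v) \<ominus>\<^bsub>M\<^esub> act M y (act M x v)"

definition lie_module_maps ::
    "('a, 'r) ring_scheme \<Rightarrow> ('a, 'l, 'p) lie_algebra_scheme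
      \<Rightarrow> ('a, 'l, 'b, 'q) lie_module_scheme \<Rightarrow> ('a, 'l, 'c, 's) lie_module_scheme \<Rightarrow> ('b \<Rightarrow> 'c) set"
  where "lie_module_maps K L M N =
    {\<phi> \<in> linear_maps K M N. \<forall>x\<in>carrier L. \<forall>v\<in>carrier M. \<phi> (act M x v) = act N x (\<phi> v)}"

definition lie_module_category ::
    "('a, 'r) ring_scheme \<Rightarrow> ('a, 'l, 'p) lie_algebra_scheme
      \<Rightarrow> (('a, 'l, 'b) lie_module, 'b \<Rightarrow> 'b) category"
  where "lie_module_category K L =
    \<lparr>Obj = {M. lie_module K L M},
     Hom = lie_module_maps K L,
     Ident = (\<lambda>M. \<lambda>x\<in>carrier M. x),
     Comp = (\<lambda>M N P \<psi> \<phi>. compose (carrier M) \<psi> \<phi>)\<rparr>"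

section \<open>The universal algebra of two Lie algebras\<close>

text \<open>Polynomials in the variables \<open>X\<^sub>s\<^sub>i\<close>: monomials are finitely supported exponent
  functions on \<^typ>\<open>nat \<times> 'i\<close>, and polynomials are finitely supported functions on monomials,
  with the convolution product of \<^theory>\<open>HOL-Library.Poly_Mapping\<close>.\<close>

type_synonym ('i, 'k) mpolynomial = "(nat \<times> 'i \<Rightarrow>\<^sub>0 nat) \<Rightarrow>\<^sub>0 'k"

definition poly_const :: "'k::field \<Rightarrow> ('i, 'k) mpolynomial"
  where "poly_const c = Poly_Mapping.single 0 c"

definition poly_var :: "nat \<Rightarrow> 'i \<Rightarrow> ('i, 'k::field) mpolynomial"
  where "poly_var s i = Poly_Mapping.single (Poly_Mapping.single (s, i) 1) 1"

definition poly_ring :: "nat \<Rightarrow> 'i set \<Rightarrow> ('i, 'k::field) mpolynomial ring"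
  where "poly_ring n I = ring_of_type_algebra
    \<lparr>carrier := {p. \<forall>m\<in>Poly_Mapping.keys p. Poly_Mapping.keys m \<subseteq> {1..n} \<times> I}\<rparr>"

text \<open>Here and below, \<open>\<tau> s t a\<close> stands for \<open>\<tau>\<^sub>s\<^sub>,\<^sub>t\<^sup>a\<close> and \<open>\<beta> i j u\<close> for \<open>\<beta>\<^sub>i\<^sub>,\<^sub>j\<^sup>u\<close>.\<close>

definition universal_relation ::
    "nat \<Rightarrow> ('i \<Rightarrow> 'i \<Rightarrow> 'i set) \<Rightarrow> ('i \<Rightarrow> 'i \<Rightarrow> 'i \<Rightarrow> 'k::field) \<Rightarrow> (nat \<Rightarrow> nat \<Rightarrow> nat \<Rightarrow> 'k)
      \<Rightarrow> nat \<Rightarrow> 'i \<Rightarrow> 'i \<Rightarrow> ('i, 'k) mpolynomial"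
  where "universal_relation n B \<beta> \<tau> a i j =
    (\<Sum>u\<in>B i j. poly_const (\<beta> i j u) * poly_var a u)
    - (\<Sum>s=1..n. \<Sum>t=1..n. poly_const (\<tau> s t a) * poly_var s i * poly_var t j)"

definition universal_ideal ::
    "nat \<Rightarrow> 'i set \<Rightarrow> ('i \<Rightarrow> 'i \<Rightarrow> 'i set) \<Rightarrow> ('i \<Rightarrow> 'i \<Rightarrow> 'i \<Rightarrow> 'k::field)
      \<Rightarrow> (nat \<Rightarrow> nat \<Rightarrow> nat \<Rightarrow> 'k) \<Rightarrow> ('i, 'k) mpolynomial set"
  where "universal_ideal n I B \<beta> \<tau> = genideal (poly_ring n I)
    {universal_relation n B \<beta> \<tau> a i j | a i j. a \<in> {1..n} \<and> i \<in> I \<and> j \<in> I}"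

definition universal_algebra ::
    "nat \<Rightarrow> 'i set \<Rightarrow> ('i \<Rightarrow> 'i \<Rightarrow> 'i set) \<Rightarrow> ('i \<Rightarrow> 'i \<Rightarrow> 'i \<Rightarrow> 'k::field)
      \<Rightarrow> (nat \<Rightarrow> nat \<Rightarrow> nat \<Rightarrow> 'k) \<Rightarrow> ('i, 'k) mpolynomial set ring"
  where "universal_algebra n I B \<beta> \<tau> = poly_ring n I Quot universal_ideal n I B \<beta> \<tau>"

definition universal_class ::
    "nat \<Rightarrow> 'i set \<Rightarrow> ('i \<Rightarrow> 'i \<Rightarrow> 'i set) \<Rightarrow> ('i \<Rightarrow> 'i \<Rightarrow> 'i \<Rightarrow> 'k::field)
      \<Rightarrow> (nat \<Rightarrow> nat \<Rightarrow> nat \<Rightarrow> 'k) \<Rightarrow> ('i, 'k) mpolynomial \<Rightarrow> ('i, 'k) mpolynomial set"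
  where "universal_class n I B \<beta> \<tau> p =
    universal_ideal n I B \<beta> \<tau> +>\<^bsub>(poly_ring n I :: ('i, 'k) mpolynomial ring)\<^esub> p"

definition universal_gen ::
    "nat \<Rightarrow> 'i set \<Rightarrow> ('i \<Rightarrow> 'i \<Rightarrow> 'i set) \<Rightarrow> ('i \<Rightarrow> 'i \<Rightarrow> 'i \<Rightarrow> 'k::field)
      \<Rightarrow> (nat \<Rightarrow> nat \<Rightarrow> nat \<Rightarrow> 'k) \<Rightarrow> nat \<Rightarrow> 'i \<Rightarrow> ('i, 'k) mpolynomial set"
  where "universal_gen n I B \<beta> \<tau> s i = universal_class n I B \<beta> \<tau> (poly_var s i)"

text \<open>The vector space underlying a module over the universal algebra.\<close>

definition underlying_space ::
    "nat \<Rightarrow> 'i set \<Rightarrow> ('i \<Rightarrow> 'i \<Rightarrow> 'i set) \<Rightarrow> ('i \<Rightarrow> 'i \<Rightarrow> 'i \<Rightarrow> 'k::field)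
      \<Rightarrow> (nat \<Rightarrow> nat \<Rightarrow> nat \<Rightarrow> 'k) \<Rightarrow> (('i, 'k) mpolynomial set, 'x) module \<Rightarrow> ('k, 'x) module"
  where "underlying_space n I B \<beta> \<tau> W =
    \<lparr>carrier = carrier W, monoid.mult = monoid.mult W, one = one W, ring.zero = ring.zero W, add = add W,
     module.smult = (\<lambda>c x. universal_class n I B \<beta> \<tau> (poly_const c) \<odot>\<^bsub>W\<^esub> x)\<rparr>"

section \<open>The tensor product of a Lie module and a module over the universal algebra\<close>

text \<open>
  \<open>basis_operator\<close> is the operator \<open>l \<otimes> t \<mapsto> \<Sum>j. (e j \<curvearrowright> l) \<otimes> (x j i \<cdot> t)\<close> by which the
  basis vector \<open>f i\<close> acts; the action of a general element of the Lie algebra is obtained by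
  expanding it in the basis \<open>f\<close>.
\<close>

definition basis_operator ::
    "nat \<Rightarrow> (nat \<Rightarrow> 'h) \<Rightarrow> 'i set \<Rightarrow> ('i \<Rightarrow> 'i \<Rightarrow> 'i set) \<Rightarrow> ('i \<Rightarrow> 'i \<Rightarrow> 'i \<Rightarrow> 'k::field)
      \<Rightarrow> (nat \<Rightarrow> nat \<Rightarrow> nat \<Rightarrow> 'k)
      \<Rightarrow> ('k, 'h, 'y) lie_module \<Rightarrow> (('i, 'k) mpolynomial set, 'x) module
      \<Rightarrow> 'i \<Rightarrow> ('y \<times> 'x \<Rightarrow>\<^sub>0 'k) set \<Rightarrow> ('y \<times> 'x \<Rightarrow>\<^sub>0 'k) set"
  where "basis_operator n e I B \<beta> \<tau> Y W i w =
    (let W\<^sub>k = underlying_space n I B \<beta> \<tau> W in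
      (\<Oplus>\<^bsub>tensor_product Y W\<^sub>k\<^esub>j\<in>{1..n}.
        tensor_map Y W\<^sub>k Y W\<^sub>k (act Y (e j)) (module.smult W (universal_gen n I B \<beta> \<tau> j i)) w))"

definition tensor_lie_module ::
    "nat \<Rightarrow> (nat \<Rightarrow> 'h) \<Rightarrow> ('k::field, 'g) lie_algebra \<Rightarrow> 'i set \<Rightarrow> ('i \<Rightarrow> 'g)
      \<Rightarrow> ('i \<Rightarrow> 'i \<Rightarrow> 'i set) \<Rightarrow> ('i \<Rightarrow> 'i \<Rightarrow> 'i \<Rightarrow> 'k) \<Rightarrow> (nat \<Rightarrow> nat \<Rightarrow> nat \<Rightarrow> 'k)
      \<Rightarrow> ('k, 'h, 'y) lie_module \<Rightarrow> (('i, 'k) mpolynomial set, 'x) module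
      \<Rightarrow> ('k, 'g, ('y \<times> 'x \<Rightarrow>\<^sub>0 'k) set) lie_module"
  where "tensor_lie_module n e L I f B \<beta> \<tau> Y W =
    (let T = tensor_product Y (underlying_space n I B \<beta> \<tau> W) in
      \<lparr>carrier = carrier T, monoid.mult = monoid.mult T, one = one T, ring.zero = ring.zero T, add = add T,
       module.smult = module.smult T,
       act = (\<lambda>z w. \<Oplus>\<^bsub>T\<^esub>i\<in>Poly_Mapping.keys (coordinates L I f z).
         Poly_Mapping.lookup (coordinates L I f z) i \<odot>\<^bsub>T\<^esub>
           basis_operator n e I B \<beta> \<tau> Y W i w)\<rparr>)"

end

theory Submission
  imports Defs
begin

text \<open>
  By bilinearity of \<open>z, w \<mapsto> z \<rightharpoonup> w\<close> and of the bracket it is enough to check the Lie module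
  identity for \<open>z = f\<^sub>i\<close>, \<open>z' = f\<^sub>j\<close> and \<open>w = l \<otimes> t\<close>. The defining relations of the universal
  algebra turn \<open>[f\<^sub>i, f\<^sub>j] \<rightharpoonup> (l \<otimes> t) = \<Sum>\<^sub>u\<^sub>,\<^sub>a \<beta>\<^sub>i\<^sub>j\<^sup>u e\<^sub>a l \<otimes> x\<^sub>a\<^sub>u t\<close> into
  \<open>\<Sum>\<^sub>a\<^sub>,\<^sub>s\<^sub>,\<^sub>r \<tau>\<^sub>s\<^sub>r\<^sup>a e\<^sub>a l \<otimes> x\<^sub>s\<^sub>i x\<^sub>r\<^sub>j t = \<Sum>\<^sub>s\<^sub>,\<^sub>r [e\<^sub>s, e\<^sub>r] l \<otimes> x\<^sub>s\<^sub>i x\<^sub>r\<^sub>j t\<close>. Expanding \<open>[e\<^sub>s, e\<^sub>r]\<close> as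
  a commutator on \<open>Y\<close> and using that \<open>x\<^sub>s\<^sub>i\<close> and \<open>x\<^sub>r\<^sub>j\<close> commute gives the commutator of the
  actions of \<open>f\<^sub>i\<close> and \<open>f\<^sub>j\<close>. Linear maps out of a tensor product that agree on pure tensors
  are equal, which reduces equivariance and functoriality to pure tensors as well.
\<close>

section \<open>Linear maps\<close>

text \<open>The action of a general \<open>z\<close> is defined through its coordinates in the basis
  \<open>f\<close>, so its linearity in \<open>z\<close> is itself a claim; it rests on the
  linearity of coordinates. The field acts on \<open>W\<close> only through the classes of constant
  polynomials. Since these commute with every x_ji, multiplication by x_ji is k-linear, and this is
  what lets the operator sending l \<otimes> t to e_j l \<otimes> x_ji t exist on the tensor product
  over k. Elements of the tensor product are cosets of formal sums, and maps out of it are unions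
  over representatives; independence of the representative is settled for all such maps by
  \<open>UN_coset_image\<close>. The two functors share one core: \<phi> \<otimes> \<psi> is
  equivariant over \<open>g\<close> as soon as \<phi> is equivariant over \<open>h\<close> and
  \<psi> is linear over the universal algebra.\<close>

lemma (in abelian_monoid) finsum_swap:
  assumes "finite A" "finite B" "\<And>a b. \<lbrakk>a \<in> A; b \<in> B\<rbrakk> \<Longrightarrow> F a b \<in> carrier G"
  shows "(\<Oplus>a\<in>A. \<Oplus>b\<in>B. F a b) = (\<Oplus>b\<in>B. \<Oplus>a\<in>A. F a b)"
  using assms(1,3)
proof (induction A rule: finite_induct)
  case empty
  then show ?case by simp
next
  case (insert x A)
  then have "(\<lambda>b. F x b) \<in> B \<rightarrow> carrier G" "(\<lambda>b. \<Oplus>a\<in>A. F a b) \<in> B \<rightarrow> carrier G"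
    by auto
  with insert have "(\<Oplus>a\<in>insert x A. \<Oplus>b\<in>B. F a b) = (\<Oplus>b\<in>B. F x b \<oplus> (\<Oplus>a\<in>A. F a b))"
    by (simp add: finsum_addf Pi_def)
  also have "\<dots> = (\<Oplus>b\<in>B. \<Oplus>a\<in>insert x A. F a b)"
    by (rule finsum_cong') (use insert in \<open>auto simp: Pi_def\<close>)
  finally show ?case .
qed

text \<open>Unlike \<open>linear_maps\<close>, no behaviour outside the carrier is prescribed.
  Operators such as a scalar multiplication or \<open>act Y z\<close>, which are total functions,
  thus count as morphisms without being restricted.\<close>

locale module_morphism = M: module R M + N: module R N for R M N +
  fixes \<phi>
  assumes hom_closed: "x \<in> carrier M \<Longrightarrow> \<phi> x \<in> carrier N"
    and hom_add: "\<lbrakk>x \<in> carrier M; y \<in> carrier M\<rbrakk> \<Longrightarrow> \<phi> (x \<oplus>\<^bsub>M\<^esub> y) = \<phi> x \<oplus>\<^bsub>N\<^esub> \<phi> y"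
    and hom_smult: "\<lbrakk>a \<in> carrier R; x \<in> carrier M\<rbrakk> \<Longrightarrow> \<phi> (a \<odot>\<^bsub>M\<^esub> x) = a \<odot>\<^bsub>N\<^esub> \<phi> x"
begin

lemma hom_zero: "\<phi> \<zero>\<^bsub>M\<^esub> = \<zero>\<^bsub>N\<^esub>"
  using hom_smult[of "\<zero>\<^bsub>R\<^esub>" "\<zero>\<^bsub>M\<^esub>"] hom_closed by simp

lemma hom_a_inv: "x \<in> carrier M \<Longrightarrow> \<phi> (\<ominus>\<^bsub>M\<^esub> x) = \<ominus>\<^bsub>N\<^esub> \<phi> x"
  by (rule N.minus_equality[symmetric])
    (simp_all add: hom_add[symmetric] hom_zero hom_closed M.l_neg)

lemma hom_minus:
  "\<lbrakk>x \<in> carrier M; y \<in> carrier M\<rbrakk> \<Longrightarrow> \<phi> (x \<ominus>\<^bsub>M\<^esub> y) = \<phi> x \<ominus>\<^bsub>N\<^esub> \<phi> y"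
  by (simp add: a_minus_def hom_add hom_a_inv)

lemma hom_finsum:
  assumes "finite A" "\<And>i. i \<in> A \<Longrightarrow> F i \<in> carrier M"
  shows "\<phi> (\<Oplus>\<^bsub>M\<^esub>i\<in>A. F i) = (\<Oplus>\<^bsub>N\<^esub>i\<in>A. \<phi> (F i))"
  using assms
  by (induction A rule: finite_induct) (simp_all add: hom_zero hom_add hom_closed Pi_def)

end

text \<open>Needed for maps that agree with a convenient formula only on the carrier, such as the
  restricted function \<open>tensor_map\<close>.\<close>

lemma module_morphism_cong:
  assumes "module_morphism R M N \<phi>" "\<And>x. x \<in> carrier M \<Longrightarrow> \<psi> x = \<phi> x"
  shows "module_morphism R M N \<psi>"
proof -
  interpret module_morphism R M N \<phi> by fact
  show ?thesis
    by unfold_locales (simp_all add: assms(2) hom_closed hom_add hom_smult)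
qed

lemma module_morphism_comp:
  assumes "module_morphism R L M \<phi>" "module_morphism R M N \<psi>"
  shows "module_morphism R L N (\<lambda>x. \<psi> (\<phi> x))"
proof -
  interpret \<phi>: module_morphism R L M \<phi> by fact
  interpret \<psi>: module_morphism R M N \<psi> by fact
  show ?thesis
    by unfold_locales (simp_all add: \<phi>.hom_closed \<phi>.hom_add \<phi>.hom_smult
        \<psi>.hom_closed \<psi>.hom_add \<psi>.hom_smult)
qed

lemma (in module) module_morphism_id: "module_morphism R M M id"
  by unfold_locales simp_all

text \<open>Commutativity of the ring is what makes a scalar multiplication linear.\<close>

lemma (in module) module_morphism_smult:
  assumes "a \<in> carrier R"
  shows "module_morphism R M M ((\<odot>\<^bsub>M\<^esub>) a)"
proof (intro module_morphism.intro module_morphism_axioms.intro)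
  fix b x
  assume "b \<in> carrier R" "x \<in> carrier M"
  with assms show "a \<odot>\<^bsub>M\<^esub> (b \<odot>\<^bsub>M\<^esub> x) = b \<odot>\<^bsub>M\<^esub> (a \<odot>\<^bsub>M\<^esub> x)"
    using smult_assoc1[of a b x] smult_assoc1[of b a x] R.m_comm[of a b] by simp
qed (use assms in \<open>auto intro: module_axioms simp: smult_r_distr\<close>)

lemma module_morphism_finsum:
  assumes "module R M" "module R N" "finite A" "\<And>i. i \<in> A \<Longrightarrow> module_morphism R M N (F i)"
  shows "module_morphism R M N (\<lambda>x. \<Oplus>\<^bsub>N\<^esub>i\<in>A. F i x)"
proof -
  interpret M: module R M by fact
  interpret N: module R N by fact
  note F = assms(4)[THEN module_morphism.hom_closed]
    assms(4)[THEN module_morphism.hom_add] assms(4)[THEN module_morphism.hom_smult]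
  show ?thesis
  proof unfold_locales
    fix x y assume xy: "x \<in> carrier M" "y \<in> carrier M"
    then have "(\<Oplus>\<^bsub>N\<^esub>i\<in>A. F i (x \<oplus>\<^bsub>M\<^esub> y)) = (\<Oplus>\<^bsub>N\<^esub>i\<in>A. F i x \<oplus>\<^bsub>N\<^esub> F i y)"
      by (intro N.finsum_cong') (auto simp: F)
    with xy show "(\<Oplus>\<^bsub>N\<^esub>i\<in>A. F i (x \<oplus>\<^bsub>M\<^esub> y)) = (\<Oplus>\<^bsub>N\<^esub>i\<in>A. F i x) \<oplus>\<^bsub>N\<^esub> (\<Oplus>\<^bsub>N\<^esub>i\<in>A. F i y)"
      by (simp add: N.finsum_addf F Pi_def)
  next
    fix a x assume ax: "a \<in> carrier R" "x \<in> carrier M"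
    then have "(\<Oplus>\<^bsub>N\<^esub>i\<in>A. F i (a \<odot>\<^bsub>M\<^esub> x)) = (\<Oplus>\<^bsub>N\<^esub>i\<in>A. a \<odot>\<^bsub>N\<^esub> F i x)"
      by (intro N.finsum_cong') (auto simp: F)
    with ax show "(\<Oplus>\<^bsub>N\<^esub>i\<in>A. F i (a \<odot>\<^bsub>M\<^esub> x)) = a \<odot>\<^bsub>N\<^esub> (\<Oplus>\<^bsub>N\<^esub>i\<in>A. F i x)"
      by (simp add: N.finsum_smult_ldistr assms(3) F Pi_def)
  qed (simp add: F Pi_def)
qed

text \<open>The passage between the morphism sets of the categories and the locale in which
  computations are done: extensionality is the only difference.\<close>

lemma linear_maps_iff:
  assumes "module R M" "module R N"
  shows "\<phi> \<in> linear_maps R M N \<longleftrightarrow> module_morphism R M N \<phi> \<and> \<phi> \<in> extensional (carrier M)"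
  using assms
  by (auto simp: linear_maps_def module_morphism_def module_morphism_axioms_def PiE_def)

section \<open>Quotient modules\<close>

text \<open>By the assumption the whole carrier is one of the submodules being intersected, so the
  family is not empty and the intersection stays inside the carrier.\<close>

lemma (in module) submodule_generated_submodule:
  assumes "S \<subseteq> carrier M"
  shows "submodule (submodule_generated R M S) R M"
proof (rule submoduleI)
  show "submodule_generated R M S \<subseteq> carrier M"
    using assms carrier_is_submodule by (auto simp: submodule_generated_def)
  show "\<zero>\<^bsub>M\<^esub> \<in> submodule_generated R M S"
    by (auto simp: submodule_generated_def submodule_def dest: subgroup.one_closed)
qed (auto simp: submodule_generated_def dest: submoduleE)

lemma submodule_generated_superset: "S \<subseteq> submodule_generated R M S"
  by (auto simp: submodule_generated_def)

lemma submodule_generated_least: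
  "\<lbrakk>submodule H R M; S \<subseteq> H\<rbrakk> \<Longrightarrow> submodule_generated R M S \<subseteq> H"
  by (auto simp: submodule_generated_def)

text \<open>Together with \<open>submodule_generated_least\<close> this shows that a linear map
  sends a generated submodule into \<open>H\<close> once it sends the generators there.\<close>

lemma (in module_morphism) vimage_submodule:
  assumes "submodule H R N"
  shows "submodule {x \<in> carrier M. \<phi> x \<in> H} R M"
  using N.submoduleE[OF assms] subgroup.one_closed[OF submodule.axioms(1)[OF assms]]
  by (intro M.submoduleI) (auto simp: hom_zero hom_a_inv hom_add hom_smult)

locale module_with_submodule = module R M for R M +
  fixes H
  assumes submodule: "submodule H R M"
begin

sublocale H: abelian_subgroup H M
  using submodule abelian_group_axioms
  by (intro abelian_subgroupI3 additive_subgroup.intro) (auto simp: submodule_def)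

lemma coset_eqI:
  assumes "x \<in> carrier M" "y \<in> carrier M" "x \<ominus>\<^bsub>M\<^esub> y \<in> H"
  shows "H +>\<^bsub>M\<^esub> x = H +>\<^bsub>M\<^esub> y"
  using assms by (metis H.a_subgroup a_repr_independence H.a_rcos_module a_minus_def)

lemma quotient_carrier: "carrier (quotient_module M H) = (\<lambda>x. H +>\<^bsub>M\<^esub> x) ` carrier M"
  by (auto simp: quotient_module_def A_RCOSETS_def')

text \<open>The zero of the quotient is \<open>H\<close>; writing it as a coset gives all elements
  the same shape, so that the rules for cosets of representatives apply to it as well.\<close>

lemma quotient_zero: "\<zero>\<^bsub>quotient_module M H\<^esub> = H +>\<^bsub>M\<^esub> \<zero>\<^bsub>M\<^esub>"
  using submodule by (simp add: quotient_module_def H.a_subset)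

lemma quotient_add:
  "\<lbrakk>x \<in> carrier M; y \<in> carrier M\<rbrakk>
    \<Longrightarrow> (H +>\<^bsub>M\<^esub> x) \<oplus>\<^bsub>quotient_module M H\<^esub> (H +>\<^bsub>M\<^esub> y) = H +>\<^bsub>M\<^esub> (x \<oplus>\<^bsub>M\<^esub> y)"
  by (simp add: quotient_module_def H.a_rcos_sum)

end

text \<open>All sets in the union are equal: two representatives differ by some
  \<open>h \<in> H\<close>, their images by \<open>\<phi> h \<in> H'\<close>. Both the scalar
  multiplication of \<open>quotient_module\<close> and the map \<open>tensor_map\<close> are unions
  of this form, and this lemma evaluates them.\<close>

lemma UN_coset_image:
  assumes "module_with_submodule R M H" "module_with_submodule R N H'"
    and "module_morphism R M N \<phi>" "\<phi> ` H \<subseteq> H'" "x \<in> carrier M"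
  shows "(\<Union>y\<in>H +>\<^bsub>M\<^esub> x. H' +>\<^bsub>N\<^esub> \<phi> y) = H' +>\<^bsub>N\<^esub> \<phi> x"
proof -
  interpret M: module_with_submodule R M H by fact
  interpret N: module_with_submodule R N H' by fact
  interpret \<phi>: module_morphism R M N \<phi> by fact
  have "H' +>\<^bsub>N\<^esub> \<phi> y = H' +>\<^bsub>N\<^esub> \<phi> x" if y: "y \<in> H +>\<^bsub>M\<^esub> x" for y
  proof -
    obtain h where h: "h \<in> H" "y = h \<oplus>\<^bsub>M\<^esub> x"
      using y by (auto simp: a_r_coset_def')
    then have "\<phi> h \<in> H'" "\<phi> y = \<phi> h \<oplus>\<^bsub>N\<^esub> \<phi> x" "\<phi> h \<in> carrier N" "\<phi> x \<in> carrier N"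
      using assms(4,5) M.H.a_subset by (auto simp: \<phi>.hom_add \<phi>.hom_closed)
    then show ?thesis
      by (intro N.coset_eqI) (simp_all add: a_minus_def N.a_assoc N.r_neg)
  qed
  \<comment> \<open>The index set of the union must also be nonempty; \<open>x\<close> represents
    its own coset.\<close>
  moreover have "x \<in> H +>\<^bsub>M\<^esub> x"
    using assms(5) by (rule M.H.a_rcos_self)
  ultimately show ?thesis by blast
qed

context module_with_submodule
begin

text \<open>The case of \<open>UN_coset_image\<close> in which \<phi> is multiplication by
  \<open>a\<close>, which maps the submodule \<open>H\<close> into itself.\<close>

lemma quotient_smult:
  assumes "a \<in> carrier R" "x \<in> carrier M"
  shows "a \<odot>\<^bsub>quotient_module M H\<^esub> (H +>\<^bsub>M\<^esub> x) = H +>\<^bsub>M\<^esub> (a \<odot>\<^bsub>M\<^esub> x)"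
  using UN_coset_image[OF _ _ module_morphism_smult, of H H a x] assms
    module_with_submodule_axioms submoduleE(4)[OF submodule]
  by (auto simp: quotient_module_def)

lemma quotient_module: "module R (quotient_module M H)"
proof (rule moduleI)
  show "abelian_group (quotient_module M H)"
  proof (rule abelian_groupI)
    fix C assume "C \<in> carrier (quotient_module M H)"
    then obtain x where "x \<in> carrier M" "C = H +>\<^bsub>M\<^esub> x"
      by (auto simp: quotient_carrier)
    then show "\<exists>D\<in>carrier (quotient_module M H).
        D \<oplus>\<^bsub>quotient_module M H\<^esub> C = \<zero>\<^bsub>quotient_module M H\<^esub>"
      by (intro bexI[of _ "H +>\<^bsub>M\<^esub> (\<ominus>\<^bsub>M\<^esub> x)"])
        (simp_all add: quotient_add quotient_zero l_neg quotient_carrier)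
  \<comment> \<open>Collapsing \<open>H +> \<zero>\<close> to \<open>H\<close> would undo
    \<open>quotient_zero\<close> and block \<open>quotient_add\<close>, so that rule is switched
    off.\<close>
  qed (auto simp: quotient_carrier quotient_add quotient_zero a_ac
      simp del: a_coset_add_zero)
qed (auto intro: R.is_cring simp: quotient_carrier quotient_add quotient_smult
    smult_l_distr smult_r_distr smult_assoc1)

lemma coset_morphism: "module_morphism R M (quotient_module M H) (\<lambda>x. H +>\<^bsub>M\<^esub> x)"
  by (intro module_morphism.intro module_morphism_axioms.intro quotient_module module_axioms)
    (simp_all add: quotient_carrier quotient_add quotient_smult)

end

text \<open>Every element of the source is the coset of some \<open>x\<close>, where the union
  equals the coset of \<open>\<phi> x\<close>; the laws are then those of \<phi> read modulo
  \<open>H'\<close>.\<close>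

lemma quotient_map_morphism:
  assumes M: "module_with_submodule R M H" and N: "module_with_submodule R N H'"
    and \<phi>: "module_morphism R M N \<phi>" "\<phi> ` H \<subseteq> H'"
  shows "module_morphism R (quotient_module M H) (quotient_module N H')
    (\<lambda>C. \<Union>x\<in>C. H' +>\<^bsub>N\<^esub> \<phi> x)"
proof -
  interpret M: module_with_submodule R M H by fact
  interpret N: module_with_submodule R N H' by fact
  interpret \<phi>: module_morphism R M N \<phi> by fact
  note image = UN_coset_image[OF assms]
  show ?thesis
    by (intro module_morphism.intro module_morphism_axioms.intro M.quotient_module N.quotient_module)
      (auto simp: M.quotient_carrier N.quotient_carrier M.quotient_add N.quotient_add
        M.quotient_smult N.quotient_smult image \<phi>.hom_closed \<phi>.hom_add \<phi>.hom_smult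
        simp del: UN_simps del: equalityI)
qed

section \<open>Free modules\<close>

lemma type_ring_simps [simp]:
  "carrier ring_of_type_algebra = UNIV"
  "\<zero>\<^bsub>ring_of_type_algebra\<^esub> = 0" "\<one>\<^bsub>ring_of_type_algebra\<^esub> = 1"
  "x \<oplus>\<^bsub>ring_of_type_algebra\<^esub> y = x + y" "x \<otimes>\<^bsub>ring_of_type_algebra\<^esub> y = x * y"
  by (simp_all add: ring_of_type_algebra_def)

lemma poly_mapping_sum_single:
  "c = (\<Sum>k\<in>Poly_Mapping.keys c. Poly_Mapping.single k (Poly_Mapping.lookup c k))"
  by (rule poly_mapping_eqI)
    (simp add: lookup_sum lookup_single when_def in_keys_iff)

lemma lookup_scale [simp]:
  fixes a :: "'k::mult_zero"
  shows "Poly_Mapping.lookup (Poly_Mapping.map ((*) a) c) k = a * Poly_Mapping.lookup c k"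
  by (simp add: Poly_Mapping.map.rep_eq when_def)

lemma keys_scale: "Poly_Mapping.keys (Poly_Mapping.map ((*) a) c) \<subseteq> Poly_Mapping.keys (c :: _ \<Rightarrow>\<^sub>0 'k::mult_zero)"
  by (auto simp: in_keys_iff)

lemma free_module_simps [simp]:
  "carrier (free_module B) = {c. Poly_Mapping.keys c \<subseteq> B}"
  "\<zero>\<^bsub>free_module B\<^esub> = 0" "c \<oplus>\<^bsub>free_module B\<^esub> d = c + d"
  "a \<odot>\<^bsub>free_module B\<^esub> c = Poly_Mapping.map ((*) a) c"
  by (simp_all add: free_module_def)

lemma free_module_module:
  "module ring_of_type_algebra (free_module B :: ('k::field, 'b \<Rightarrow>\<^sub>0 'k) module)"
proof (rule moduleI)
  show "abelian_group (free_module B :: ('k, 'b \<Rightarrow>\<^sub>0 'k) module)"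
  proof (rule abelian_groupI)
    fix c :: "'b \<Rightarrow>\<^sub>0 'k"
    assume "c \<in> carrier (free_module B)"
    then show "\<exists>d\<in>carrier (free_module B). d \<oplus>\<^bsub>free_module B\<^esub> c = \<zero>\<^bsub>free_module B\<^esub>"
      by (intro bexI[of _ "- c"]) (simp_all)
  next
    fix c d :: "'b \<Rightarrow>\<^sub>0 'k"
    assume "c \<in> carrier (free_module B)" "d \<in> carrier (free_module B)"
    then show "c \<oplus>\<^bsub>free_module B\<^esub> d \<in> carrier (free_module B)"
      using Poly_Mapping.keys_add[of c d] by auto
  qed (simp_all add: ac_simps)
  fix a :: 'k and c :: "'b \<Rightarrow>\<^sub>0 'k"
  assume "c \<in> carrier (free_module B)"
  then show "a \<odot>\<^bsub>free_module B\<^esub> c \<in> carrier (free_module B)"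
    using keys_scale[of a c] by auto
qed (auto intro!: poly_mapping_eqI simp: lookup_add algebra_simps)

text \<open>The inverse in a record is the one found inside its carrier, so it matches the minus of
  the type only once membership is known.\<close>

lemma free_module_a_inv:
  fixes c :: "'b \<Rightarrow>\<^sub>0 'k::field"
  assumes "c \<in> carrier (free_module B)"
  shows "\<ominus>\<^bsub>(free_module B :: ('k, 'b \<Rightarrow>\<^sub>0 'k) module)\<^esub> c = - c"
proof -
  interpret module ring_of_type_algebra "free_module B :: ('k, 'b \<Rightarrow>\<^sub>0 'k) module"
    by (rule free_module_module)
  show ?thesis
    by (rule minus_equality) (use assms in \<open>simp_all\<close>)
qed

lemma free_module_minus:
  fixes c d :: "'b \<Rightarrow>\<^sub>0 'k::field"
  assumes "d \<in> carrier (free_module B)"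
  shows "c \<ominus>\<^bsub>(free_module B :: ('k, 'b \<Rightarrow>\<^sub>0 'k) module)\<^esub> d = c - d"
  by (simp only: a_minus_def free_module_a_inv[OF assms]) simp


text \<open>The map induced by \<open>h\<close> on free modules. As \<open>h\<close> need not be
  injective, it is a sum of singletons: coefficients over the same image point add up. For
  \<open>h = map_prod \<phi> \<psi>\<close> it is the inner sum of
  \<open>tensor_map\<close>.\<close>

definition free_map :: "('b \<Rightarrow> 'c) \<Rightarrow> ('b \<Rightarrow>\<^sub>0 'k::field) \<Rightarrow> ('c \<Rightarrow>\<^sub>0 'k)"
  where "free_map h c =
    (\<Sum>b\<in>Poly_Mapping.keys c. Poly_Mapping.single (h b) (Poly_Mapping.lookup c b))"

lemma free_map_add: "free_map h (c + d) = free_map h c + free_map h d"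
  unfolding free_map_def by (rule setsum_keys_plus_distrib) (simp_all add: single_add)

lemma free_map_minus: "free_map h (c - d) = free_map h c - free_map h d"
  using free_map_add[of h "c - d" d] by simp

lemma free_map_single [simp]: "free_map h (Poly_Mapping.single b a) = Poly_Mapping.single (h b) a"
  by (cases "a = 0") (simp_all add: free_map_def)

lemma scale_sum:
  "Poly_Mapping.map ((*) a) (sum F A) = (\<Sum>i\<in>A. Poly_Mapping.map ((*) (a :: 'k::field)) (F i))"
  by (rule poly_mapping_eqI) (simp add: lookup_sum sum_distrib_left)

lemma scale_single:
  "Poly_Mapping.map ((*) a) (Poly_Mapping.single b c) = Poly_Mapping.single b (a * c :: 'k::field)"
  by (rule poly_mapping_eqI) (simp add: lookup_single when_def)

lemma free_map_scale:
  "free_map h (Poly_Mapping.map ((*) a) c) = Poly_Mapping.map ((*) a) (free_map h c)"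
proof -
  have "free_map h (Poly_Mapping.map ((*) a) c) = (\<Sum>b\<in>Poly_Mapping.keys c.
      Poly_Mapping.single (h b) (Poly_Mapping.lookup (Poly_Mapping.map ((*) a) c) b))"
    unfolding free_map_def
    \<comment> \<open>Scaling by zero empties the support, so the sum is extended to the support of
      \<open>c\<close> by vanishing terms.\<close>
    by (rule sum.mono_neutral_left) (use keys_scale[of a c] in \<open>auto simp: in_keys_iff\<close>)
  then show ?thesis
    by (simp add: free_map_def scale_sum scale_single)
qed

lemma free_map_morphism:
  fixes h :: "'b \<Rightarrow> 'c"
  assumes "h \<in> B \<rightarrow> B'"
  shows "module_morphism ring_of_type_algebra (free_module B) (free_module B')
    (free_map h :: ('b \<Rightarrow>\<^sub>0 'k::field) \<Rightarrow> _)"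
proof (intro module_morphism.intro module_morphism_axioms.intro free_module_module)
  fix c :: "'b \<Rightarrow>\<^sub>0 'k"
  assume "c \<in> carrier (free_module B)"
  with assms show "free_map h c \<in> carrier (free_module B')"
    using keys_sum[of "\<lambda>b. Poly_Mapping.single (h b) (Poly_Mapping.lookup c b)" "Poly_Mapping.keys c"]
    by (fastforce simp: free_map_def split: if_splits)
qed (simp_all add: free_map_add free_map_scale)

section \<open>Tensor products\<close>

text \<open>Named apart from the submodule it spans because the relations are handled at the level
  of generators: they prove bilinearity of pure tensors, and \<open>free_map\<close> carries each to
  one of the same kind.\<close>

definition tensor_generators ::
    "('k::field, 'b, 'p) module_scheme \<Rightarrow> ('k, 'c, 'q) module_scheme \<Rightarrow> ('b \<times> 'c \<Rightarrow>\<^sub>0 'k) set"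
  where "tensor_generators M N =
    {Poly_Mapping.single (x \<oplus>\<^bsub>M\<^esub> x', y) 1
        - Poly_Mapping.single (x, y) 1 - Poly_Mapping.single (x', y) 1 |
        x x' y. x \<in> carrier M \<and> x' \<in> carrier M \<and> y \<in> carrier N} \<union>
     {Poly_Mapping.single (x, y \<oplus>\<^bsub>N\<^esub> y') 1
        - Poly_Mapping.single (x, y) 1 - Poly_Mapping.single (x, y') 1 |
        x y y'. x \<in> carrier M \<and> y \<in> carrier N \<and> y' \<in> carrier N} \<union>
     {Poly_Mapping.single (a \<odot>\<^bsub>M\<^esub> x, y) 1 - Poly_Mapping.single (x, y) a |
        a x y. x \<in> carrier M \<and> y \<in> carrier N} \<union>
     {Poly_Mapping.single (x, a \<odot>\<^bsub>N\<^esub> y) 1 - Poly_Mapping.single (x, y) a |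
        a x y. x \<in> carrier M \<and> y \<in> carrier N}"

lemma tensor_relations_eq:
  "tensor_relations M N = submodule_generated ring_of_type_algebra
    (free_module (carrier M \<times> carrier N)) (tensor_generators M N)"
  by (simp add: tensor_relations_def tensor_generators_def)

lemma tensor_generators_add_left: "\<lbrakk>x \<in> carrier M; x' \<in> carrier M; y \<in> carrier N\<rbrakk> \<Longrightarrow>
    Poly_Mapping.single (x \<oplus>\<^bsub>M\<^esub> x', y) 1 - Poly_Mapping.single (x, y) 1
      - Poly_Mapping.single (x', y) 1 \<in> tensor_generators M N"
  and tensor_generators_add_right: "\<lbrakk>x \<in> carrier M; y \<in> carrier N; y' \<in> carrier N\<rbrakk> \<Longrightarrow>
    Poly_Mapping.single (x, y \<oplus>\<^bsub>N\<^esub> y') 1 - Poly_Mapping.single (x, y) 1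
      - Poly_Mapping.single (x, y') 1 \<in> tensor_generators M N"
  and tensor_generators_smult_left: "\<lbrakk>x \<in> carrier M; y \<in> carrier N\<rbrakk> \<Longrightarrow>
    Poly_Mapping.single (a \<odot>\<^bsub>M\<^esub> x, y) 1 - Poly_Mapping.single (x, y) a \<in> tensor_generators M N"
  and tensor_generators_smult_right: "\<lbrakk>x \<in> carrier M; y \<in> carrier N\<rbrakk> \<Longrightarrow>
    Poly_Mapping.single (x, a \<odot>\<^bsub>N\<^esub> y) 1 - Poly_Mapping.single (x, y) a \<in> tensor_generators M N"
  unfolding tensor_generators_def by blast+

lemmas tensor_generatorsI = tensor_generators_add_left tensor_generators_add_right
  tensor_generators_smult_left tensor_generators_smult_right

section \<open>Pure tensors: bilinearity, generation and uniqueness of maps\<close>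

locale tensor = M: module ring_of_type_algebra M + N: module ring_of_type_algebra N
  for M :: "('k::field, 'b, 'p) module_scheme" and N :: "('k, 'c, 'q) module_scheme"
begin

abbreviation free :: "('k, 'b \<times> 'c \<Rightarrow>\<^sub>0 'k) module"
  where "free \<equiv> free_module (carrier M \<times> carrier N)"

lemma smult_closed_left [simp, intro]: "x \<in> carrier M \<Longrightarrow> a \<odot>\<^bsub>M\<^esub> x \<in> carrier M"
  and smult_closed_right [simp, intro]: "y \<in> carrier N \<Longrightarrow> a \<odot>\<^bsub>N\<^esub> y \<in> carrier N"
  by (simp_all add: M.smult_closed N.smult_closed)

lemma single_in_free:
  "\<lbrakk>x \<in> carrier M; y \<in> carrier N\<rbrakk> \<Longrightarrow> Poly_Mapping.single (x, y) a \<in> carrier free"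
  by simp

lemma minus_in_free: "\<lbrakk>c \<in> carrier free; d \<in> carrier free\<rbrakk> \<Longrightarrow> c - d \<in> carrier free"
  using Poly_Mapping.keys_diff[of c d] by auto

lemma tensor_generators_subset: "tensor_generators M N \<subseteq> carrier free"
  unfolding tensor_generators_def
  by (intro Un_least) (clarsimp simp del: free_module_simps; intro minus_in_free single_in_free; blast)+

sublocale Q: module_with_submodule ring_of_type_algebra free "tensor_relations M N"
  by (intro module_with_submodule.intro module_with_submodule_axioms.intro free_module_module)
    (unfold tensor_relations_eq, intro module.submodule_generated_submodule free_module_module
      tensor_generators_subset)

sublocale module ring_of_type_algebra "tensor_product M N"
  unfolding tensor_product_def by (rule Q.quotient_module)

lemma coset_morphism:
  "module_morphism ring_of_type_algebra free (tensor_product M N)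
    (\<lambda>c. tensor_relations M N +>\<^bsub>free\<^esub> c)"
  unfolding tensor_product_def by (rule Q.coset_morphism)

lemma pure_tensor_closed [simp]:
  "\<lbrakk>x \<in> carrier M; y \<in> carrier N\<rbrakk> \<Longrightarrow> pure_tensor M N x y \<in> carrier (tensor_product M N)"
  unfolding pure_tensor_def by (rule module_morphism.hom_closed[OF coset_morphism single_in_free])

lemma tensor_generators_subset_relations: "tensor_generators M N \<subseteq> tensor_relations M N"
  unfolding tensor_relations_eq by (rule submodule_generated_superset)

lemma coset_eq_if_generator:
  assumes "c - d \<in> tensor_generators M N" "c \<in> carrier free" "d \<in> carrier free"
  shows "tensor_relations M N +>\<^bsub>free\<^esub> c = tensor_relations M N +>\<^bsub>free\<^esub> d"
proof (rule Q.coset_eqI[OF assms(2,3)])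
  show "c \<ominus>\<^bsub>free\<^esub> d \<in> tensor_relations M N"
    unfolding free_module_minus[OF assms(3)]
    by (rule subsetD[OF tensor_generators_subset_relations assms(1)])
qed

lemma pure_tensor_add_left:
  assumes "x \<in> carrier M" "x' \<in> carrier M" "y \<in> carrier N"
  shows "pure_tensor M N (x \<oplus>\<^bsub>M\<^esub> x') y
    = pure_tensor M N x y \<oplus>\<^bsub>tensor_product M N\<^esub> pure_tensor M N x' y"
proof -
  have "tensor_relations M N +>\<^bsub>free\<^esub> Poly_Mapping.single (x \<oplus>\<^bsub>M\<^esub> x', y) 1
    = tensor_relations M N +>\<^bsub>free\<^esub> (Poly_Mapping.single (x, y) 1 \<oplus>\<^bsub>free\<^esub> Poly_Mapping.single (x', y) 1)"
  proof (rule coset_eq_if_generator)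
    show "Poly_Mapping.single (x \<oplus>\<^bsub>M\<^esub> x', y) 1 - (Poly_Mapping.single (x, y) 1 \<oplus>\<^bsub>free\<^esub> Poly_Mapping.single (x', y) 1)
      \<in> tensor_generators M N"
      \<comment> \<open>The generators are written as p - q - r, the goal as p - (q + r).\<close>
      unfolding tensor_generators_def free_module_simps
        diff_diff_add[symmetric] using assms by blast
  qed (use assms in \<open>auto intro!: Q.a_closed single_in_free simp del: free_module_simps\<close>)
  then show ?thesis
    unfolding pure_tensor_def
    by (subst module_morphism.hom_add[OF coset_morphism, symmetric]) (simp_all add: assms)
qed

lemma pure_tensor_add_right:
  assumes "x \<in> carrier M" "y \<in> carrier N" "y' \<in> carrier N"
  shows "pure_tensor M N x (y \<oplus>\<^bsub>N\<^esub> y')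
    = pure_tensor M N x y \<oplus>\<^bsub>tensor_product M N\<^esub> pure_tensor M N x y'"
proof -
  have "tensor_relations M N +>\<^bsub>free\<^esub> Poly_Mapping.single (x, y \<oplus>\<^bsub>N\<^esub> y') 1
    = tensor_relations M N +>\<^bsub>free\<^esub> (Poly_Mapping.single (x, y) 1 \<oplus>\<^bsub>free\<^esub> Poly_Mapping.single (x, y') 1)"
  proof (rule coset_eq_if_generator)
    show "Poly_Mapping.single (x, y \<oplus>\<^bsub>N\<^esub> y') 1 - (Poly_Mapping.single (x, y) 1 \<oplus>\<^bsub>free\<^esub> Poly_Mapping.single (x, y') 1)
      \<in> tensor_generators M N"
      unfolding tensor_generators_def free_module_simps
        diff_diff_add[symmetric] using assms by blast
  qed (use assms in \<open>auto intro!: Q.a_closed single_in_free simp del: free_module_simps\<close>)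
  then show ?thesis
    unfolding pure_tensor_def
    by (subst module_morphism.hom_add[OF coset_morphism, symmetric]) (simp_all add: assms)
qed

text \<open>The scalar relations carry the scalar as a coefficient in the free module; this turns
  that coefficient into a scalar of the tensor product.\<close>

lemma coset_single:
  assumes "x \<in> carrier M" "y \<in> carrier N"
  shows "tensor_relations M N +>\<^bsub>free\<^esub> Poly_Mapping.single (x, y) a
    = a \<odot>\<^bsub>tensor_product M N\<^esub> pure_tensor M N x y"
  unfolding pure_tensor_def
  by (subst module_morphism.hom_smult[OF coset_morphism, symmetric])
    (simp_all add: assms scale_single)

lemma pure_tensor_smult_left:
  assumes "x \<in> carrier M" "y \<in> carrier N"
  shows "pure_tensor M N (a \<odot>\<^bsub>M\<^esub> x) y = a \<odot>\<^bsub>tensor_product M N\<^esub> pure_tensor M N x y"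
  unfolding coset_single[OF assms, symmetric] unfolding pure_tensor_def
proof (rule coset_eq_if_generator)
  show "Poly_Mapping.single (a \<odot>\<^bsub>M\<^esub> x, y) 1 - Poly_Mapping.single (x, y) a \<in> tensor_generators M N"
    unfolding tensor_generators_def using assms by blast
qed (use assms in \<open>auto intro!: Q.a_closed single_in_free simp del: free_module_simps\<close>)

lemma pure_tensor_smult_right:
  assumes "x \<in> carrier M" "y \<in> carrier N"
  shows "pure_tensor M N x (a \<odot>\<^bsub>N\<^esub> y) = a \<odot>\<^bsub>tensor_product M N\<^esub> pure_tensor M N x y"
  unfolding coset_single[OF assms, symmetric] unfolding pure_tensor_def
proof (rule coset_eq_if_generator)
  show "Poly_Mapping.single (x, a \<odot>\<^bsub>N\<^esub> y) 1 - Poly_Mapping.single (x, y) a \<in> tensor_generators M N"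
    unfolding tensor_generators_def using assms by blast
qed (use assms in \<open>auto intro!: Q.a_closed single_in_free simp del: free_module_simps\<close>)

lemma pure_tensor_left_morphism:
  "y \<in> carrier N \<Longrightarrow> module_morphism ring_of_type_algebra M (tensor_product M N) (\<lambda>x. pure_tensor M N x y)"
  by unfold_locales (simp_all add: pure_tensor_add_left pure_tensor_smult_left)

lemma pure_tensor_right_morphism:
  "x \<in> carrier M \<Longrightarrow> module_morphism ring_of_type_algebra N (tensor_product M N) (pure_tensor M N x)"
  by unfold_locales (simp_all add: pure_tensor_add_right pure_tensor_smult_right)

text \<open>No case for scalar multiples is required, since a(x \<otimes> y) = (ax) \<otimes> y is
  again pure. Every element is thus a sum of pure tensors, and additivity alone carries the
  induction.\<close>

lemma tensor_induct [consumes 1, case_names pure add]: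
  assumes "w \<in> carrier (tensor_product M N)"
    and pure: "\<And>x y. \<lbrakk>x \<in> carrier M; y \<in> carrier N\<rbrakk> \<Longrightarrow> P (pure_tensor M N x y)"
    and add: "\<And>v w. \<lbrakk>v \<in> carrier (tensor_product M N); w \<in> carrier (tensor_product M N); P v; P w\<rbrakk>
      \<Longrightarrow> P (v \<oplus>\<^bsub>tensor_product M N\<^esub> w)"
  shows "P w"
proof -
  interpret q: module_morphism ring_of_type_algebra free "tensor_product M N"
      "\<lambda>c. tensor_relations M N +>\<^bsub>free\<^esub> c"
    by (rule coset_morphism)
  let ?q = "\<lambda>c. tensor_relations M N +>\<^bsub>free\<^esub> c"
  have single: "P (?q (Poly_Mapping.single p a))" if "p \<in> carrier M \<times> carrier N" for p a
    using that pure[of "a \<odot>\<^bsub>M\<^esub> fst p" "snd p"]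
    by (cases p) (simp add: coset_single pure_tensor_smult_left)
  \<comment> \<open>The pair of zeros is merely a point sure to lie in the carriers; its coefficient
    0 makes the formal sum vanish.\<close>
  have zero: "P (?q 0)"
    using single[of "(\<zero>\<^bsub>M\<^esub>, \<zero>\<^bsub>N\<^esub>)" 0] by simp
  \<comment> \<open>Membership is carried along because the hypothesis \<open>add\<close> asks for
    elements of the tensor product.\<close>
  have sum: "P (?q (\<Sum>p\<in>A. Poly_Mapping.single p (c p)))
      \<and> (\<Sum>p\<in>A. Poly_Mapping.single p (c p)) \<in> carrier free"
    if "finite A" "A \<subseteq> carrier M \<times> carrier N" for A c
    using that
  proof (induction A rule: finite_induct)
    case empty
    then show ?case using zero by simp
  next
    case (insert p A)
    let ?s = "Poly_Mapping.single p (c p)" and ?t = "\<Sum>p\<in>A. Poly_Mapping.single p (c p)"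
    have s: "?s \<in> carrier free" "P (?q ?s)" and t: "?t \<in> carrier free" "P (?q ?t)"
      using insert single by auto
    have "P (?q (?s \<oplus>\<^bsub>free\<^esub> ?t))" "?s \<oplus>\<^bsub>free\<^esub> ?t \<in> carrier free"
      using q.hom_add[OF s(1) t(1)] add[OF q.hom_closed[OF s(1)] q.hom_closed[OF t(1)] s(2) t(2)]
        Q.a_closed[OF s(1) t(1)] by (simp_all only:)
    with insert show ?case by simp
  qed
  obtain c where c: "c \<in> carrier free" "w = ?q c"
    using assms(1) by (auto simp: tensor_product_def Q.quotient_carrier)
  then have "P (?q (\<Sum>p\<in>Poly_Mapping.keys c. Poly_Mapping.single p (Poly_Mapping.lookup c p)))"
    by (intro sum[THEN conjunct1]) simp_all
  then show ?thesis
    by (simp only: c(2) flip: poly_mapping_sum_single)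
qed

lemma morphism_eqI:
  assumes "module_morphism ring_of_type_algebra (tensor_product M N) P \<phi>"
    and "module_morphism ring_of_type_algebra (tensor_product M N) P \<psi>"
    and "\<And>x y. \<lbrakk>x \<in> carrier M; y \<in> carrier N\<rbrakk>
      \<Longrightarrow> \<phi> (pure_tensor M N x y) = \<psi> (pure_tensor M N x y)"
    and "w \<in> carrier (tensor_product M N)"
  shows "\<phi> w = \<psi> w"
  using assms(4)
  by (induction w rule: tensor_induct)
    (simp_all add: assms(3) module_morphism.hom_add[OF assms(1)] module_morphism.hom_add[OF assms(2)])

end

text \<open>Linearity of \<phi> and \<psi> makes \<open>F\<close>, the induced map of free modules,
  send each defining relation to a defining relation of the same kind. Hence the preimage of the
  relations of the target is a submodule containing the generators, and \<open>F\<close> descends to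
  the quotients.\<close>

lemma tensor_map_morphism_and_pure:
  fixes M :: "('k::field, 'b, 'p) module_scheme" and N :: "('k, 'c, 'q) module_scheme"
    and M' :: "('k, 'd, 'r) module_scheme" and N' :: "('k, 'e, 's) module_scheme"
  assumes \<phi>: "module_morphism ring_of_type_algebra M M' \<phi>"
    and \<psi>: "module_morphism ring_of_type_algebra N N' \<psi>"
  shows tensor_map_morphism: "module_morphism ring_of_type_algebra
      (tensor_product M N) (tensor_product M' N') (tensor_map M N M' N' \<phi> \<psi>)"
    and tensor_map_pure: "\<lbrakk>x \<in> carrier M; y \<in> carrier N\<rbrakk>
      \<Longrightarrow> tensor_map M N M' N' \<phi> \<psi> (pure_tensor M N x y) = pure_tensor M' N' (\<phi> x) (\<psi> y)"
proof -
  interpret \<phi>: module_morphism ring_of_type_algebra M M' \<phi> by fact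
  interpret \<psi>: module_morphism ring_of_type_algebra N N' \<psi> by fact
  interpret S: tensor M N ..
  interpret T: tensor M' N' ..
  define F where "F = (free_map (map_prod \<phi> \<psi>) :: ('b \<times> 'c \<Rightarrow>\<^sub>0 'k) \<Rightarrow> _)"
  have F: "module_morphism ring_of_type_algebra S.free T.free F"
    unfolding F_def by (rule free_map_morphism) (auto simp: \<phi>.hom_closed \<psi>.hom_closed)
  have "F c \<in> tensor_generators M' N'" if "c \<in> tensor_generators M N" for c
    using that unfolding tensor_generators_def[of M N] F_def
    by (elim UnE) (auto simp: free_map_minus \<phi>.hom_add \<psi>.hom_add \<phi>.hom_smult \<psi>.hom_smult
        \<phi>.hom_closed \<psi>.hom_closed intro!: tensor_generatorsI)
  then have "tensor_generators M N \<subseteq> {c \<in> carrier S.free. F c \<in> tensor_relations M' N'}"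
    using S.tensor_generators_subset T.tensor_generators_subset_relations by auto
  then have "tensor_relations M N \<subseteq> {c \<in> carrier S.free. F c \<in> tensor_relations M' N'}"
    unfolding tensor_relations_eq[of M N]
    by (intro submodule_generated_least module_morphism.vimage_submodule[OF F] T.Q.submodule)
  then have sub: "F ` tensor_relations M N \<subseteq> tensor_relations M' N'"
    by blast
  let ?G = "\<lambda>C. \<Union>c\<in>C. tensor_relations M' N' +>\<^bsub>T.free\<^esub> F c"
  \<comment> \<open>\<open>tensor_map\<close> is restricted to the carrier, while the descended map
    \<open>?G\<close> is not; they are compared only there.\<close>
  have G: "tensor_map M N M' N' \<phi> \<psi> C = ?G C" if "C \<in> carrier (tensor_product M N)" for C
    using that by (simp add: tensor_map_def F_def free_map_def map_prod_def case_prod_beta)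
  show "module_morphism ring_of_type_algebra
      (tensor_product M N) (tensor_product M' N') (tensor_map M N M' N' \<phi> \<psi>)"
  proof (rule module_morphism_cong[OF _ G])
    show "module_morphism ring_of_type_algebra (tensor_product M N) (tensor_product M' N') ?G"
      unfolding tensor_product_def
      by (rule quotient_map_morphism[OF S.Q.module_with_submodule_axioms
            T.Q.module_with_submodule_axioms F sub])
  qed
  assume xy: "x \<in> carrier M" "y \<in> carrier N"
  have "?G (pure_tensor M N x y) = pure_tensor M' N' (\<phi> x) (\<psi> y)"
    unfolding pure_tensor_def
    by (subst UN_coset_image[OF S.Q.module_with_submodule_axioms
            T.Q.module_with_submodule_axioms F sub S.single_in_free[OF xy]])
      (simp add: F_def)
  then show "tensor_map M N M' N' \<phi> \<psi> (pure_tensor M N x y) = pure_tensor M' N' (\<phi> x) (\<psi> y)"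
    by (simp add: G xy)
qed

section \<open>Bases\<close>

lemma module_morphism_minus:
  assumes "module_morphism R M N \<phi>" "module_morphism R M N \<psi>"
  shows "module_morphism R M N (\<lambda>x. \<phi> x \<ominus>\<^bsub>N\<^esub> \<psi> x)"
proof -
  interpret \<phi>: module_morphism R M N \<phi> by fact
  interpret \<psi>: module_morphism R M N \<psi> by fact
  show ?thesis
    by unfold_locales
      (simp_all add: \<phi>.hom_closed \<psi>.hom_closed \<phi>.hom_add \<psi>.hom_add \<phi>.hom_smult \<psi>.hom_smult
        a_minus_def \<phi>.N.minus_add \<phi>.N.a_ac \<phi>.N.smult_r_distr \<phi>.N.smult_r_minus)
qed

text \<open>Combinations are summed over the support of their coefficients, which changes under
  addition and scaling. Padding with zero terms allows a common index set.\<close>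

lemma linear_combination_superset:
  assumes "module ring_of_type_algebra M" "finite A" "Poly_Mapping.keys c \<subseteq> A" "b \<in> A \<rightarrow> carrier M"
  shows "linear_combination M b c = (\<Oplus>\<^bsub>M\<^esub>i\<in>A. Poly_Mapping.lookup c i \<odot>\<^bsub>M\<^esub> b i)"
proof -
  interpret module ring_of_type_algebra M by fact
  show ?thesis
    unfolding linear_combination_def
  proof (rule M.add.finprod_mono_neutral_cong_left[OF assms(2,3)])
    fix i assume "i \<in> A - Poly_Mapping.keys c"
    with assms(4) show "Poly_Mapping.lookup c i \<odot>\<^bsub>M\<^esub> b i = \<zero>\<^bsub>M\<^esub>"
      using smult_l_null[of "b i"] by (auto simp: in_keys_iff)
  qed (use assms(4) in auto)
qed

lemma linear_combination_morphism:
  fixes M :: "('k::field, 'b, 'p) module_scheme" and b :: "'i \<Rightarrow> 'b"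
  assumes "module ring_of_type_algebra M" "b \<in> J \<rightarrow> carrier M"
  shows "module_morphism ring_of_type_algebra (free_module J) M (linear_combination M b)"
proof -
  interpret module ring_of_type_algebra M by fact
  note sup = linear_combination_superset[OF assms(1)]
  show ?thesis
  proof (intro module_morphism.intro module_morphism_axioms.intro free_module_module assms(1))
    fix c :: "'i \<Rightarrow>\<^sub>0 'k" assume "c \<in> carrier (free_module J)"
    with assms(2) have "b \<in> Poly_Mapping.keys c \<rightarrow> carrier M" by auto
    then show "linear_combination M b c \<in> carrier M"
      by (auto simp: linear_combination_def Pi_iff intro!: finsum_closed)
  next
    fix c d :: "'i \<Rightarrow>\<^sub>0 'k"
    let ?A = "Poly_Mapping.keys c \<union> Poly_Mapping.keys d"
    assume "c \<in> carrier (free_module J)" "d \<in> carrier (free_module J)"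
    then have b: "b \<in> ?A \<rightarrow> carrier M" using assms(2) by auto
    \<comment> \<open>Cancellation can make the support of \<open>c + d\<close> smaller than
      \<open>?A\<close>; all three combinations are compared over \<open>?A\<close>.\<close>
    then have "linear_combination M b (c + d)
        = (\<Oplus>\<^bsub>M\<^esub>i\<in>?A. Poly_Mapping.lookup c i \<odot>\<^bsub>M\<^esub> b i \<oplus>\<^bsub>M\<^esub> Poly_Mapping.lookup d i \<odot>\<^bsub>M\<^esub> b i)"
      using smult_l_distr
      by (subst sup[of ?A]) (auto simp: Poly_Mapping.keys_add lookup_add Pi_iff intro!: finsum_cong'
          simp del: M.finsum_addf)
    also have "\<dots> = linear_combination M b c \<oplus>\<^bsub>M\<^esub> linear_combination M b d"
      using b by (subst (1 2) sup[of ?A]) (auto simp: Pi_iff finsum_addf)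
    finally show "linear_combination M b (c \<oplus>\<^bsub>free_module J\<^esub> d)
        = linear_combination M b c \<oplus>\<^bsub>M\<^esub> linear_combination M b d"
      by simp
  next
    fix a :: 'k and c :: "'i \<Rightarrow>\<^sub>0 'k"
    assume "c \<in> carrier (free_module J)"
    then have b: "b \<in> Poly_Mapping.keys c \<rightarrow> carrier M" using assms(2) by auto
    then have "linear_combination M b (Poly_Mapping.map ((*) a) c)
        = (\<Oplus>\<^bsub>M\<^esub>i\<in>Poly_Mapping.keys c. a \<odot>\<^bsub>M\<^esub> (Poly_Mapping.lookup c i \<odot>\<^bsub>M\<^esub> b i))"
      using smult_assoc1
      by (subst sup[of "Poly_Mapping.keys c"]) (auto simp: keys_scale Pi_iff intro!: finsum_cong')
    then show "linear_combination M b (a \<odot>\<^bsub>free_module J\<^esub> c) = a \<odot>\<^bsub>M\<^esub> linear_combination M b c"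
      using b finsum_smult_ldistr[of "Poly_Mapping.keys c" a "\<lambda>i. Poly_Mapping.lookup c i \<odot>\<^bsub>M\<^esub> b i"]
      by (auto simp: linear_combination_def Pi_iff)
  qed
qed

lemma linear_combination_single:
  assumes "module ring_of_type_algebra M" "b i \<in> carrier M"
  shows "linear_combination M b (Poly_Mapping.single i (1 :: 'k::field)) = b i"
proof -
  interpret module ring_of_type_algebra M by fact
  show ?thesis using assms(2) smult_one[of "b i"] by (simp add: linear_combination_def)
qed

section \<open>Coordinates in a basis\<close>

locale based_module = module ring_of_type_algebra M
  for M :: "('k::field, 'b, 'p) module_scheme" +
  fixes J :: "'i set" and b :: "'i \<Rightarrow> 'b"
  assumes basis: "is_basis M J b"
begin

lemma basis_closed: "i \<in> J \<Longrightarrow> b i \<in> carrier M"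
  using basis by (auto simp: is_basis_def)

lemma combination_morphism:
  "module_morphism ring_of_type_algebra (free_module J) M (linear_combination M b)"
  by (rule linear_combination_morphism) (auto intro: module_axioms basis_closed)

text \<open>A basis is defined by a trivial kernel; linearity of combinations turns this into
  injectivity on coefficients supported in \<open>J\<close>.\<close>

lemma linear_combination_inj:
  assumes "Poly_Mapping.keys c \<subseteq> J" "Poly_Mapping.keys d \<subseteq> J"
    and "linear_combination M b c = linear_combination M b d"
  shows "c = d"
proof -
  interpret l: module_morphism ring_of_type_algebra "free_module J" M "linear_combination M b"
    by (rule combination_morphism)
  have c: "c \<in> carrier (free_module J)" and d: "d \<in> carrier (free_module J)"
    using assms by auto
  have "linear_combination M b (c - d) = \<zero>\<^bsub>M\<^esub>"
    using l.hom_minus[OF c d] l.hom_closed[OF d] assms(3)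
    unfolding free_module_minus[OF d] by (simp add: r_neg a_minus_def)
  moreover have "Poly_Mapping.keys (c - d) \<subseteq> J"
    using Poly_Mapping.keys_diff[of c d] assms by blast
  moreover have "\<forall>c. Poly_Mapping.keys c \<subseteq> J \<and> linear_combination M b c = \<zero>\<^bsub>M\<^esub> \<longrightarrow> c = 0"
    using basis by (simp add: is_basis_def)
  ultimately have "c - d = 0" by blast
  then show ?thesis by simp
qed

text \<open>Uniqueness makes the description in \<open>coordinates\<close> definite, so coordinates
  are computed by exhibiting any combination that yields \<open>v\<close>.\<close>

lemma coordinates_eqI:
  "\<lbrakk>Poly_Mapping.keys c \<subseteq> J; linear_combination M b c = v\<rbrakk> \<Longrightarrow> coordinates M J b v = c"
  unfolding coordinates_def using linear_combination_inj by (intro the_equality) auto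

lemma coordinates:
  assumes "v \<in> carrier M"
  shows keys_coordinates: "Poly_Mapping.keys (coordinates M J b v) \<subseteq> J"
    and linear_combination_coordinates: "linear_combination M b (coordinates M J b v) = v"
proof -
  obtain c where "Poly_Mapping.keys c \<subseteq> J" "linear_combination M b c = v"
    using basis assms by (auto simp: is_basis_def)
  then show "Poly_Mapping.keys (coordinates M J b v) \<subseteq> J"
    "linear_combination M b (coordinates M J b v) = v"
    by (simp_all add: coordinates_eqI)
qed

lemma coordinates_basis: "i \<in> J \<Longrightarrow> coordinates M J b (b i) = Poly_Mapping.single i 1"
  by (rule coordinates_eqI)
    (simp_all add: linear_combination_single module_axioms basis_closed)

text \<open>The inverse of a linear bijection is linear: the sum of two coordinate vectors combines
  to the sum of the vectors, so by uniqueness it is its coordinate vector, and likewise for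
  multiples.\<close>

lemma coordinates_morphism:
  "module_morphism ring_of_type_algebra M (free_module J) (coordinates M J b)"
proof -
  interpret l: module_morphism ring_of_type_algebra "free_module J" M "linear_combination M b"
    by (rule combination_morphism)
  have mem: "coordinates M J b v \<in> carrier (free_module J)" if "v \<in> carrier M" for v
    using that by (simp add: keys_coordinates)
  show ?thesis
  proof unfold_locales
    fix v w assume vw: "v \<in> carrier M" "w \<in> carrier M"
    show "coordinates M J b (v \<oplus>\<^bsub>M\<^esub> w)
        = coordinates M J b v \<oplus>\<^bsub>free_module J\<^esub> coordinates M J b w"
      by (rule coordinates_eqI)
        (use l.M.a_closed[OF mem mem] l.hom_add[OF mem mem] vw in
          \<open>simp_all add: linear_combination_coordinates\<close>)
  next
    fix a v assume "v \<in> carrier M"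
    then show "coordinates M J b (a \<odot>\<^bsub>M\<^esub> v) = a \<odot>\<^bsub>free_module J\<^esub> coordinates M J b v"
      by (intro coordinates_eqI)
        (use l.M.smult_closed[OF _ mem, of a v] l.hom_smult[OF _ mem, of a v] in
          \<open>simp_all add: linear_combination_coordinates\<close>)
  qed (use mem in auto)
qed

lemma morphism_eqI:
  assumes "module_morphism ring_of_type_algebra M N \<phi>" "module_morphism ring_of_type_algebra M N \<psi>"
    and "\<And>i. i \<in> J \<Longrightarrow> \<phi> (b i) = \<psi> (b i)" and "v \<in> carrier M"
  shows "\<phi> v = \<psi> v"
proof -
  interpret \<phi>: module_morphism ring_of_type_algebra M N \<phi> by fact
  interpret \<psi>: module_morphism ring_of_type_algebra M N \<psi> by fact
  define c where "c = coordinates M J b v"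
  have c: "Poly_Mapping.keys c \<subseteq> J" "v = (\<Oplus>\<^bsub>M\<^esub>i\<in>Poly_Mapping.keys c. Poly_Mapping.lookup c i \<odot>\<^bsub>M\<^esub> b i)"
    using coordinates[OF assms(4)] by (auto simp: c_def linear_combination_def)
  have mem: "Poly_Mapping.lookup c i \<odot>\<^bsub>M\<^esub> b i \<in> carrier M" if "i \<in> Poly_Mapping.keys c" for i
    using that c(1) basis_closed by auto
  have "(\<Oplus>\<^bsub>N\<^esub>i\<in>Poly_Mapping.keys c. \<phi> (Poly_Mapping.lookup c i \<odot>\<^bsub>M\<^esub> b i))
      = (\<Oplus>\<^bsub>N\<^esub>i\<in>Poly_Mapping.keys c. \<psi> (Poly_Mapping.lookup c i \<odot>\<^bsub>M\<^esub> b i))"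
    by (rule \<phi>.N.finsum_cong')
      (use c(1) basis_closed mem in \<open>auto simp: \<phi>.hom_smult \<psi>.hom_smult assms(3) subset_iff intro: \<psi>.hom_closed\<close>)
  then show ?thesis
    unfolding c(2) by (simp add: \<phi>.hom_finsum \<psi>.hom_finsum mem)
qed

end

section \<open>The universal algebra\<close>

lemma poly_ring_simps [simp]:
  "carrier (poly_ring n I) = {p. \<forall>m\<in>Poly_Mapping.keys p. Poly_Mapping.keys m \<subseteq> {1..n} \<times> I}"
  "\<zero>\<^bsub>poly_ring n I\<^esub> = 0" "\<one>\<^bsub>poly_ring n I\<^esub> = 1"
  "p \<oplus>\<^bsub>poly_ring n I\<^esub> q = p + q" "p \<otimes>\<^bsub>poly_ring n I\<^esub> q = p * q"
  by (simp_all add: poly_ring_def ring_of_type_algebra_def)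

text \<open>The ring laws hold in the ambient type of polynomials over all variables; what remains
  is closure of the chosen carrier.\<close>

lemma poly_ring_cring: "cring (poly_ring n I :: ('i, 'k::field) mpolynomial ring)"
proof (rule cringI)
  show "abelian_group (poly_ring n I :: ('i, 'k) mpolynomial ring)"
  proof (rule abelian_groupI)
    fix p q :: "('i, 'k) mpolynomial"
    assume p: "p \<in> carrier (poly_ring n I)"
    then show "\<exists>q\<in>carrier (poly_ring n I). q \<oplus>\<^bsub>poly_ring n I\<^esub> p = \<zero>\<^bsub>poly_ring n I\<^esub>"
      by (intro bexI[of _ "- p"]) (simp_all)
    assume "q \<in> carrier (poly_ring n I)"
    with p show "p \<oplus>\<^bsub>poly_ring n I\<^esub> q \<in> carrier (poly_ring n I)"
      using Poly_Mapping.keys_add[of p q] by auto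
  qed (simp_all add: ac_simps)
  show "Group.comm_monoid (poly_ring n I :: ('i, 'k) mpolynomial ring)"
  proof (rule comm_monoidI)
    fix p q :: "('i, 'k) mpolynomial"
    assume pq: "p \<in> carrier (poly_ring n I)" "q \<in> carrier (poly_ring n I)"
    \<comment> \<open>A monomial of a product has exponent a + b, with a and b exponents from the
      factors, so it involves only variables of those two.\<close>
    have "Poly_Mapping.keys m \<subseteq> {1..n} \<times> I" if m: "m \<in> Poly_Mapping.keys (p * q)" for m
    proof -
      obtain a b where "m = a + b" "a \<in> Poly_Mapping.keys p" "b \<in> Poly_Mapping.keys q"
        using m Poly_Mapping.keys_mult[of p q] by blast
      then show ?thesis
        using pq Poly_Mapping.keys_add[of a b] by fastforce
    qed
    then show "p \<otimes>\<^bsub>poly_ring n I\<^esub> q \<in> carrier (poly_ring n I)"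
      by simp
  qed (simp_all add: ac_simps)
qed (simp_all add: distrib_right)

lemma poly_const_closed: "poly_const c \<in> carrier (poly_ring n I)"
  by (simp add: poly_const_def)

lemma poly_var_closed: "\<lbrakk>s \<in> {1..n}; i \<in> I\<rbrakk> \<Longrightarrow> poly_var s i \<in> carrier (poly_ring n I)"
  by (simp add: poly_var_def)

text \<open>The defining relations are written with the operations of the type; closure is restated
  for these in place of the record operations.\<close>

lemma poly_ring_add_closed:
  "\<lbrakk>p \<in> carrier (poly_ring n I); q \<in> carrier (poly_ring n I)\<rbrakk> \<Longrightarrow> p + q \<in> carrier (poly_ring n I)"
  using ring.ring_simprules(1)[OF cring.axioms(1)[OF poly_ring_cring]] by (metis poly_ring_simps(4))

lemma poly_ring_mult_closed:
  "\<lbrakk>p \<in> carrier (poly_ring n I); q \<in> carrier (poly_ring n I)\<rbrakk> \<Longrightarrow> p * q \<in> carrier (poly_ring n I)"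
  using ring.ring_simprules(5)[OF cring.axioms(1)[OF poly_ring_cring]] by (metis poly_ring_simps(5))

lemma poly_ring_diff_closed:
  "\<lbrakk>p \<in> carrier (poly_ring n I); q \<in> carrier (poly_ring n I)\<rbrakk> \<Longrightarrow> p - q \<in> carrier (poly_ring n I)"
  using Poly_Mapping.keys_diff[of p q] by auto

lemma poly_ring_sum_closed:
  "(\<And>a. a \<in> A \<Longrightarrow> F a \<in> carrier (poly_ring n I)) \<Longrightarrow> sum F A \<in> carrier (poly_ring n I)"
proof (induction A rule: infinite_finite_induct)
  case (insert a A)
  have "F a \<in> carrier (poly_ring n I)" "sum F A \<in> carrier (poly_ring n I)"
    using insert.prems insert.IH by blast+
  then show ?case
    using insert.hyps poly_ring_add_closed by (simp del: poly_ring_simps)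
qed simp_all

lemmas poly_ring_closed = poly_const_closed poly_var_closed poly_ring_add_closed
  poly_ring_mult_closed poly_ring_diff_closed poly_ring_sum_closed

text \<open>The inclusion \<open>B i j \<subseteq> I\<close> places the relations inside
  \<open>poly_ring n I\<close>; finiteness makes the sums over \<open>B i j\<close> genuine.\<close>

locale universal_algebra_data =
  fixes n :: nat and I :: "'i set" and B :: "'i \<Rightarrow> 'i \<Rightarrow> 'i set"
    and \<beta> :: "'i \<Rightarrow> 'i \<Rightarrow> 'i \<Rightarrow> 'k::field" and \<tau> :: "nat \<Rightarrow> nat \<Rightarrow> nat \<Rightarrow> 'k"
  assumes B: "\<lbrakk>i \<in> I; j \<in> I\<rbrakk> \<Longrightarrow> finite (B i j) \<and> B i j \<subseteq> I"
begin

abbreviation R :: "('i, 'k) mpolynomial ring" where "R \<equiv> poly_ring n I"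
abbreviation A :: "('i, 'k) mpolynomial set ring" where "A \<equiv> universal_algebra n I B \<beta> \<tau>"
abbreviation cls :: "('i, 'k) mpolynomial \<Rightarrow> ('i, 'k) mpolynomial set"
  where "cls \<equiv> universal_class n I B \<beta> \<tau>"
abbreviation x :: "nat \<Rightarrow> 'i \<Rightarrow> ('i, 'k) mpolynomial set"
  where "x \<equiv> universal_gen n I B \<beta> \<tau>"

lemma universal_relation_closed:
  assumes "a \<in> {1..n}" "i \<in> I" "j \<in> I"
  shows "universal_relation n B \<beta> \<tau> a i j \<in> carrier R"
  unfolding universal_relation_def using assms B[OF assms(2,3)]
  by (intro poly_ring_closed) auto

abbreviation "relations \<equiv> {universal_relation n B \<beta> \<tau> a i j | a i j. a \<in> {1..n} \<and> i \<in> I \<and> j \<in> I}"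

lemma relations_subset: "relations \<subseteq> carrier R"
  using universal_relation_closed by blast

sublocale J: ideal "universal_ideal n I B \<beta> \<tau>" R
  unfolding universal_ideal_def
  by (rule ring.genideal_ideal[OF cring.axioms(1)[OF poly_ring_cring] relations_subset])

lemma universal_class_hom: "ring_hom_cring R A cls"
  using J.rcos_ring_hom_cring[OF poly_ring_cring]
  by (simp add: universal_algebra_def universal_class_def[abs_def])

lemma universal_class_relation:
  assumes "a \<in> {1..n}" "i \<in> I" "j \<in> I"
  shows "cls (universal_relation n B \<beta> \<tau> a i j) = \<zero>\<^bsub>A\<^esub>"
proof -
  have "universal_relation n B \<beta> \<tau> a i j \<in> universal_ideal n I B \<beta> \<tau>"
    unfolding universal_ideal_def
    using ring.genideal_self[OF cring.axioms(1)[OF poly_ring_cring] relations_subset] assms by blast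
  then show ?thesis
    by (simp add: universal_class_def universal_algebra_def FactRing_def J.a_rcos_const)
qed

end

section \<open>Modules over the universal algebra as vector spaces\<close>

lemma underlying_space_simps [simp]:
  "carrier (underlying_space n I B \<beta> \<tau> W) = carrier W"
  "\<zero>\<^bsub>underlying_space n I B \<beta> \<tau> W\<^esub> = \<zero>\<^bsub>W\<^esub>"
  "v \<oplus>\<^bsub>underlying_space n I B \<beta> \<tau> W\<^esub> w = v \<oplus>\<^bsub>W\<^esub> w"
  "c \<odot>\<^bsub>underlying_space n I B \<beta> \<tau> W\<^esub> w = universal_class n I B \<beta> \<tau> (poly_const c) \<odot>\<^bsub>W\<^esub> w"
  by (simp_all add: underlying_space_def)

locale universal_module = universal_algebra_data n I B \<beta> \<tau> + W: module A W
  for n :: nat and I :: "'i set" and B :: "'i \<Rightarrow> 'i \<Rightarrow> 'i set"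
    and \<beta> :: "'i \<Rightarrow> 'i \<Rightarrow> 'i \<Rightarrow> 'k::field" and \<tau> :: "nat \<Rightarrow> nat \<Rightarrow> nat \<Rightarrow> 'k"
    and W :: "(('i, 'k) mpolynomial set, 'x) module"
begin

abbreviation W\<^sub>k :: "('k, 'x) module" where "W\<^sub>k \<equiv> underlying_space n I B \<beta> \<tau> W"

sublocale cls: ring_hom_cring R A cls
  by (rule universal_class_hom)

lemma cls_add: "\<lbrakk>p \<in> carrier R; q \<in> carrier R\<rbrakk> \<Longrightarrow> cls (p + q) = cls p \<oplus>\<^bsub>A\<^esub> cls q"
  using cls.hom_add[of p q] by simp

lemma cls_mult: "\<lbrakk>p \<in> carrier R; q \<in> carrier R\<rbrakk> \<Longrightarrow> cls (p * q) = cls p \<otimes>\<^bsub>A\<^esub> cls q"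
  using cls.hom_mult[of p q] by simp

lemma smult_cls_closed: "\<lbrakk>p \<in> carrier R; w \<in> carrier W\<rbrakk> \<Longrightarrow> cls p \<odot>\<^bsub>W\<^esub> w \<in> carrier W"
  by (rule W.smult_closed[OF cls.hom_closed])

lemma smult_cls_mult:
  "\<lbrakk>p \<in> carrier R; q \<in> carrier R; w \<in> carrier W\<rbrakk> \<Longrightarrow> cls (p * q) \<odot>\<^bsub>W\<^esub> w = cls p \<odot>\<^bsub>W\<^esub> (cls q \<odot>\<^bsub>W\<^esub> w)"
  by (simp only: cls_mult W.smult_assoc1 cls.hom_closed)

lemma smult_cls_add:
  "\<lbrakk>p \<in> carrier R; q \<in> carrier R; w \<in> carrier W\<rbrakk>
    \<Longrightarrow> cls (p + q) \<odot>\<^bsub>W\<^esub> w = cls p \<odot>\<^bsub>W\<^esub> w \<oplus>\<^bsub>W\<^esub> cls q \<odot>\<^bsub>W\<^esub> w"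
  by (simp only: cls_add W.smult_l_distr cls.hom_closed)

text \<open>Restriction of scalars along the ring homomorphism that sends a scalar to the class of
  its constant polynomial.\<close>

sublocale W\<^sub>k: module ring_of_type_algebra W\<^sub>k
proof (rule moduleI)
  show "abelian_group W\<^sub>k"
  proof (rule abelian_groupI)
    fix v assume "v \<in> carrier W\<^sub>k"
    then show "\<exists>w\<in>carrier W\<^sub>k. w \<oplus>\<^bsub>W\<^sub>k\<^esub> v = \<zero>\<^bsub>W\<^sub>k\<^esub>"
      by (intro bexI[of _ "\<ominus>\<^bsub>W\<^esub> v"]) (simp_all add: W.l_neg)
  qed (simp_all add: W.a_ac)
  fix c d :: 'k and v w
  assume "v \<in> carrier W\<^sub>k"
  then have v: "v \<in> carrier W" by simp
  show "c \<odot>\<^bsub>W\<^sub>k\<^esub> v \<in> carrier W\<^sub>k"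
    using smult_cls_closed[OF poly_const_closed v] by simp
  show "(c \<oplus>\<^bsub>ring_of_type_algebra\<^esub> d) \<odot>\<^bsub>W\<^sub>k\<^esub> v = c \<odot>\<^bsub>W\<^sub>k\<^esub> v \<oplus>\<^bsub>W\<^sub>k\<^esub> d \<odot>\<^bsub>W\<^sub>k\<^esub> v"
    using smult_cls_add[OF poly_const_closed poly_const_closed v, of c d]
    by (simp add: poly_const_def single_add)
  show "(c \<otimes>\<^bsub>ring_of_type_algebra\<^esub> d) \<odot>\<^bsub>W\<^sub>k\<^esub> v = c \<odot>\<^bsub>W\<^sub>k\<^esub> (d \<odot>\<^bsub>W\<^sub>k\<^esub> v)"
    using smult_cls_mult[OF poly_const_closed poly_const_closed v, of c d]
    by (simp add: poly_const_def mult_single)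
  show "\<one>\<^bsub>ring_of_type_algebra\<^esub> \<odot>\<^bsub>W\<^sub>k\<^esub> v = v"
    using cls.hom_one v by (simp add: poly_const_def)
  assume "w \<in> carrier W\<^sub>k"
  then show "c \<odot>\<^bsub>W\<^sub>k\<^esub> (v \<oplus>\<^bsub>W\<^sub>k\<^esub> w) = c \<odot>\<^bsub>W\<^sub>k\<^esub> v \<oplus>\<^bsub>W\<^sub>k\<^esub> c \<odot>\<^bsub>W\<^sub>k\<^esub> w"
    using W.smult_r_distr[OF cls.hom_closed[OF poly_const_closed] v] by simp
qed (rule cring_from_type_algebra)

lemma smult_cls_commute:
  assumes "p \<in> carrier R" "q \<in> carrier R" "w \<in> carrier W"
  shows "cls p \<odot>\<^bsub>W\<^esub> (cls q \<odot>\<^bsub>W\<^esub> w) = cls q \<odot>\<^bsub>W\<^esub> (cls p \<odot>\<^bsub>W\<^esub> w)"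
  using assms by (simp only: smult_cls_mult[symmetric] mult.commute)

text \<open>Linearity over the field is commutation with classes of constants, which holds because
  the polynomial ring is commutative.\<close>

lemma smult_cls_morphism:
  assumes "p \<in> carrier R"
  shows "module_morphism ring_of_type_algebra W\<^sub>k W\<^sub>k ((\<odot>\<^bsub>W\<^esub>) (cls p))"
proof unfold_locales
  fix v assume v: "v \<in> carrier W\<^sub>k"
  then show "cls p \<odot>\<^bsub>W\<^esub> v \<in> carrier W\<^sub>k"
    using smult_cls_closed[OF assms] by simp
  show "cls p \<odot>\<^bsub>W\<^esub> (c \<odot>\<^bsub>W\<^sub>k\<^esub> v) = c \<odot>\<^bsub>W\<^sub>k\<^esub> (cls p \<odot>\<^bsub>W\<^esub> v)" for c
    using smult_cls_commute[OF assms poly_const_closed] v by simp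
  fix w assume "w \<in> carrier W\<^sub>k"
  with v show "cls p \<odot>\<^bsub>W\<^esub> (v \<oplus>\<^bsub>W\<^sub>k\<^esub> w) = cls p \<odot>\<^bsub>W\<^esub> v \<oplus>\<^bsub>W\<^sub>k\<^esub> cls p \<odot>\<^bsub>W\<^esub> w"
    using W.smult_r_distr[OF cls.hom_closed[OF assms]] by simp
qed

lemma x_morphism:
  "\<lbrakk>s \<in> {1..n}; i \<in> I\<rbrakk> \<Longrightarrow> module_morphism ring_of_type_algebra W\<^sub>k W\<^sub>k ((\<odot>\<^bsub>W\<^esub>) (x s i))"
  unfolding universal_gen_def by (intro smult_cls_morphism poly_var_closed)

lemma x_commute:
  "\<lbrakk>s \<in> {1..n}; i \<in> I; t \<in> {1..n}; j \<in> I; w \<in> carrier W\<rbrakk>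
    \<Longrightarrow> x s i \<odot>\<^bsub>W\<^esub> (x t j \<odot>\<^bsub>W\<^esub> w) = x t j \<odot>\<^bsub>W\<^esub> (x s i \<odot>\<^bsub>W\<^esub> w)"
  unfolding universal_gen_def by (intro smult_cls_commute poly_var_closed)

lemma smult_cls_sum:
  assumes "finite S" "\<And>a. a \<in> S \<Longrightarrow> F a \<in> carrier R" "w \<in> carrier W"
  shows "cls (sum F S) \<odot>\<^bsub>W\<^esub> w = (\<Oplus>\<^bsub>W\<^sub>k\<^esub>a\<in>S. cls (F a) \<odot>\<^bsub>W\<^esub> w)"
  using assms
proof (induction S rule: finite_induct)
  case empty
  then show ?case using cls.hom_zero by simp
next
  case (insert a S)
  have "sum F S \<in> carrier R" by (rule poly_ring_sum_closed) (use insert in blast)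
  moreover have "(\<lambda>a. cls (F a) \<odot>\<^bsub>W\<^esub> w) \<in> S \<rightarrow> carrier W\<^sub>k"
    using insert.prems smult_cls_closed by (auto simp del: poly_ring_simps)
  ultimately show ?case
    using insert smult_cls_add[of "F a" "sum F S" w] smult_cls_closed[of "F a" w]
    by (simp add: W\<^sub>k.finsum_insert del: poly_ring_simps)
qed

text \<open>The class of a defining relation is zero, so its two halves \<open>?p\<close> and
  \<open>?q\<close> have the same class and act equally on \<open>w\<close>; expanding both actions
  gives the two sides.\<close>

lemma x_relation:
  assumes a: "a \<in> {1..n}" and ij: "i \<in> I" "j \<in> I" and w: "w \<in> carrier W"
  shows "(\<Oplus>\<^bsub>W\<^sub>k\<^esub>u\<in>B i j. \<beta> i j u \<odot>\<^bsub>W\<^sub>k\<^esub> (x a u \<odot>\<^bsub>W\<^esub> w))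
    = (\<Oplus>\<^bsub>W\<^sub>k\<^esub>s\<in>{1..n}. \<Oplus>\<^bsub>W\<^sub>k\<^esub>t\<in>{1..n}. \<tau> s t a \<odot>\<^bsub>W\<^sub>k\<^esub> (x s i \<odot>\<^bsub>W\<^esub> (x t j \<odot>\<^bsub>W\<^esub> w)))"
proof -
  let ?p = "\<Sum>u\<in>B i j. poly_const (\<beta> i j u) * poly_var a u"
  let ?q = "\<Sum>s=1..n. \<Sum>t=1..n. poly_const (\<tau> s t a) * poly_var s i * poly_var t j"
  note Bij = B[OF ij]
  have p: "\<And>u. u \<in> B i j \<Longrightarrow> poly_const (\<beta> i j u) * poly_var a u \<in> carrier R"
    using a Bij by (intro poly_ring_closed) auto
  have q: "\<And>s t. \<lbrakk>s \<in> {1..n}; t \<in> {1..n}\<rbrakk>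
      \<Longrightarrow> poly_const (\<tau> s t a) * poly_var s i * poly_var t j \<in> carrier R"
    using ij by (intro poly_ring_closed)
  \<comment> \<open>Moving \<open>?q\<close> to the other side means that only additivity of
    \<open>cls\<close> is needed.\<close>
  have "?p = universal_relation n B \<beta> \<tau> a i j + ?q"
    by (simp add: universal_relation_def)
  moreover have "?q \<in> carrier R"
    using q by (intro poly_ring_sum_closed)
  ultimately have "cls ?p = cls ?q"
    using cls_add[OF universal_relation_closed[OF a ij], of ?q] universal_class_relation[OF a ij]
      cls.hom_closed[of ?q] by (simp del: poly_ring_simps)
  then have "cls ?p \<odot>\<^bsub>W\<^esub> w = cls ?q \<odot>\<^bsub>W\<^esub> w" by simp
  moreover have "cls ?p \<odot>\<^bsub>W\<^esub> w = (\<Oplus>\<^bsub>W\<^sub>k\<^esub>u\<in>B i j. \<beta> i j u \<odot>\<^bsub>W\<^sub>k\<^esub> (x a u \<odot>\<^bsub>W\<^esub> w))"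
  proof (subst smult_cls_sum[OF _ p w])
    show "finite (B i j)" using Bij by simp
    show "(\<Oplus>\<^bsub>W\<^sub>k\<^esub>u\<in>B i j. cls (poly_const (\<beta> i j u) * poly_var a u) \<odot>\<^bsub>W\<^esub> w)
      = (\<Oplus>\<^bsub>W\<^sub>k\<^esub>u\<in>B i j. \<beta> i j u \<odot>\<^bsub>W\<^sub>k\<^esub> (x a u \<odot>\<^bsub>W\<^esub> w))"
    proof (rule W\<^sub>k.finsum_cong'[OF refl funcsetI])
      fix u assume "u \<in> B i j"
      with a Bij have u: "poly_var a u \<in> carrier R" by (intro poly_var_closed) auto
      show "cls (poly_const (\<beta> i j u) * poly_var a u) \<odot>\<^bsub>W\<^esub> w = \<beta> i j u \<odot>\<^bsub>W\<^sub>k\<^esub> (x a u \<odot>\<^bsub>W\<^esub> w)"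
        by (simp add: smult_cls_mult[OF poly_const_closed u w] universal_gen_def)
      show "\<beta> i j u \<odot>\<^bsub>W\<^sub>k\<^esub> (x a u \<odot>\<^bsub>W\<^esub> w) \<in> carrier W\<^sub>k"
        unfolding universal_gen_def using smult_cls_closed[OF u w] by (intro W\<^sub>k.smult_closed) auto
    qed
  qed
  moreover have "cls ?q \<odot>\<^bsub>W\<^esub> w
    = (\<Oplus>\<^bsub>W\<^sub>k\<^esub>s\<in>{1..n}. \<Oplus>\<^bsub>W\<^sub>k\<^esub>t\<in>{1..n}. \<tau> s t a \<odot>\<^bsub>W\<^sub>k\<^esub> (x s i \<odot>\<^bsub>W\<^esub> (x t j \<odot>\<^bsub>W\<^esub> w)))"
  proof -
    have eq: "cls (poly_const (\<tau> s t a) * poly_var s i * poly_var t j) \<odot>\<^bsub>W\<^esub> w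
        = \<tau> s t a \<odot>\<^bsub>W\<^sub>k\<^esub> (x s i \<odot>\<^bsub>W\<^esub> (x t j \<odot>\<^bsub>W\<^esub> w))"
      and closed: "\<tau> s t a \<odot>\<^bsub>W\<^sub>k\<^esub> (x s i \<odot>\<^bsub>W\<^esub> (x t j \<odot>\<^bsub>W\<^esub> w)) \<in> carrier W\<^sub>k"
      if st: "s \<in> {1..n}" "t \<in> {1..n}" for s t
    proof -
      \<comment> \<open>The premises do not mention the coefficient field, so its type is fixed by
        hand.\<close>
      note s = poly_var_closed[OF st(1) ij(1), where 'b = 'k]
      note t = poly_var_closed[OF st(2) ij(2), where 'b = 'k]
      note tw = smult_cls_closed[OF t w]
      note stw = smult_cls_closed[OF s tw]
      show "cls (poly_const (\<tau> s t a) * poly_var s i * poly_var t j) \<odot>\<^bsub>W\<^esub> w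
          = \<tau> s t a \<odot>\<^bsub>W\<^sub>k\<^esub> (x s i \<odot>\<^bsub>W\<^esub> (x t j \<odot>\<^bsub>W\<^esub> w))"
        by (simp add: smult_cls_mult[OF poly_ring_mult_closed[OF poly_const_closed s] t w]
            smult_cls_mult[OF poly_const_closed s tw] universal_gen_def)
      show "\<tau> s t a \<odot>\<^bsub>W\<^sub>k\<^esub> (x s i \<odot>\<^bsub>W\<^esub> (x t j \<odot>\<^bsub>W\<^esub> w)) \<in> carrier W\<^sub>k"
        unfolding universal_gen_def using stw by (intro W\<^sub>k.smult_closed) auto
    qed
    have "cls ?q \<odot>\<^bsub>W\<^esub> w = (\<Oplus>\<^bsub>W\<^sub>k\<^esub>s\<in>{1..n}.
        cls (\<Sum>t=1..n. poly_const (\<tau> s t a) * poly_var s i * poly_var t j) \<odot>\<^bsub>W\<^esub> w)"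
      using q w by (intro smult_cls_sum poly_ring_sum_closed) auto
    also have "\<dots> = (\<Oplus>\<^bsub>W\<^sub>k\<^esub>s\<in>{1..n}. \<Oplus>\<^bsub>W\<^sub>k\<^esub>t\<in>{1..n}. \<tau> s t a \<odot>\<^bsub>W\<^sub>k\<^esub> (x s i \<odot>\<^bsub>W\<^esub> (x t j \<odot>\<^bsub>W\<^esub> w)))"
    proof (rule W\<^sub>k.finsum_cong'[OF refl])
      show "(\<lambda>s. \<Oplus>\<^bsub>W\<^sub>k\<^esub>t\<in>{1..n}. \<tau> s t a \<odot>\<^bsub>W\<^sub>k\<^esub> (x s i \<odot>\<^bsub>W\<^esub> (x t j \<odot>\<^bsub>W\<^esub> w))) \<in> {1..n} \<rightarrow> carrier W\<^sub>k"
        by (intro funcsetI W\<^sub>k.finsum_closed closed)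
      fix s assume s: "s \<in> {1..n}"
      have "cls (\<Sum>t=1..n. poly_const (\<tau> s t a) * poly_var s i * poly_var t j) \<odot>\<^bsub>W\<^esub> w
        = (\<Oplus>\<^bsub>W\<^sub>k\<^esub>t\<in>{1..n}. cls (poly_const (\<tau> s t a) * poly_var s i * poly_var t j) \<odot>\<^bsub>W\<^esub> w)"
        using q s w by (intro smult_cls_sum) auto
      also have "\<dots> = (\<Oplus>\<^bsub>W\<^sub>k\<^esub>t\<in>{1..n}. \<tau> s t a \<odot>\<^bsub>W\<^sub>k\<^esub> (x s i \<odot>\<^bsub>W\<^esub> (x t j \<odot>\<^bsub>W\<^esub> w)))"
        by (intro W\<^sub>k.finsum_cong'[OF refl] funcsetI closed eq s)
      finally show "cls (\<Sum>t=1..n. poly_const (\<tau> s t a) * poly_var s i * poly_var t j) \<odot>\<^bsub>W\<^esub> w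
        = (\<Oplus>\<^bsub>W\<^sub>k\<^esub>t\<in>{1..n}. \<tau> s t a \<odot>\<^bsub>W\<^sub>k\<^esub> (x s i \<odot>\<^bsub>W\<^esub> (x t j \<odot>\<^bsub>W\<^esub> w)))" .
    qed
    finally show ?thesis .
  qed
  ultimately show ?thesis by simp
qed

end

section \<open>The Lie module structure on the tensor product\<close>

lemma (in abelian_group) finsum_diff:
  assumes "finite A" "\<And>i. i \<in> A \<Longrightarrow> F i \<in> carrier G" "\<And>i. i \<in> A \<Longrightarrow> F' i \<in> carrier G"
  shows "(\<Oplus>i\<in>A. F i \<ominus> F' i) = (\<Oplus>i\<in>A. F i) \<ominus> (\<Oplus>i\<in>A. F' i)"
  using assms
proof (induction A rule: finite_induct)
  case empty
  then show ?case by (simp add: a_minus_def r_neg del: l_zero)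
next
  case (insert a A)
  then have "F \<in> A \<rightarrow> carrier G" "F' \<in> A \<rightarrow> carrier G" "(\<lambda>i. F i \<ominus> F' i) \<in> A \<rightarrow> carrier G"
    by auto
  with insert show ?case
    by (simp add: a_minus_def minus_add a_ac)
qed

text \<open>Congruence with pointwise premises, in a shape that can be iterated through nested sums
  by \<open>intro\<close>.\<close>

lemma (in abelian_monoid) finsum_eqI:
  assumes "\<And>i. i \<in> A \<Longrightarrow> F i = F' i" "\<And>i. i \<in> A \<Longrightarrow> F' i \<in> carrier G"
  shows "(\<Oplus>i\<in>A. F i) = (\<Oplus>i\<in>A. F' i)"
  by (rule finsum_cong'[OF refl funcsetI]) (use assms in auto)

lemma (in lie_algebra) bracket_left_morphism:
  "y \<in> carrier L \<Longrightarrow> module_morphism K L L (\<lambda>z. bracket L z y)"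
  by (intro module_morphism.intro module_morphism_axioms.intro L.module_axioms)
    (simp_all add: bracket_closed bracket_add_left bracket_smult_left)

lemma (in lie_algebra) bracket_right_morphism:
  "y \<in> carrier L \<Longrightarrow> module_morphism K L L (bracket L y)"
  by (intro module_morphism.intro module_morphism_axioms.intro L.module_axioms)
    (simp_all add: bracket_closed bracket_add_right bracket_smult_right)

lemma (in lie_module) act_left_morphism:
  "v \<in> carrier M \<Longrightarrow> module_morphism K L M (\<lambda>z. act M z v)"
  by (intro module_morphism.intro module_morphism_axioms.intro L.L.module_axioms M.module_axioms)
    (simp_all add: act_closed act_add_left act_smult_left)

lemma (in lie_module) act_right_morphism:
  "z \<in> carrier L \<Longrightarrow> module_morphism K M M (act M z)"
  by (intro module_morphism.intro module_morphism_axioms.intro M.module_axioms)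
    (simp_all add: act_closed act_add_right act_smult_right)

text \<open>Contains the data of the two Lie algebras but no module, so that several choices of
  \<open>Y\<close> and \<open>W\<close> can be compared inside it, as functoriality demands.\<close>

locale lie_algebra_pair = universal_algebra_data n I B \<beta> \<tau> +
    g: lie_algebra ring_of_type_algebra g + h: lie_algebra ring_of_type_algebra h
  for n :: nat and I :: "'i set" and B :: "'i \<Rightarrow> 'i \<Rightarrow> 'i set"
    and \<beta> :: "'i \<Rightarrow> 'i \<Rightarrow> 'i \<Rightarrow> 'k::field" and \<tau> :: "nat \<Rightarrow> nat \<Rightarrow> nat \<Rightarrow> 'k"
    and g :: "('k, 'g) lie_algebra" and h :: "('k, 'h) lie_algebra" +
  fixes f :: "'i \<Rightarrow> 'g" and e :: "nat \<Rightarrow> 'h"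
  assumes basis_g: "is_basis g I f" and basis_h: "is_basis h {1..n} e"
    and bracket_h: "\<lbrakk>i \<in> {1..n}; j \<in> {1..n}\<rbrakk>
      \<Longrightarrow> bracket h (e i) (e j) = (\<Oplus>\<^bsub>h\<^esub>s\<in>{1..n}. \<tau> i j s \<odot>\<^bsub>h\<^esub> e s)"
    and bracket_g: "\<And>i j. \<lbrakk>i \<in> I; j \<in> I\<rbrakk>
      \<Longrightarrow> bracket g (f i) (f j) = (\<Oplus>\<^bsub>g\<^esub>u\<in>B i j. \<beta> i j u \<odot>\<^bsub>g\<^esub> f u)"
begin

sublocale bg: based_module g I f
  by (intro based_module.intro based_module_axioms.intro basis_g g.L.module_axioms)

sublocale bh: based_module h "{1..n}" e
  by (intro based_module.intro based_module_axioms.intro basis_h h.L.module_axioms)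

end

locale tensor_action = lie_algebra_pair n I B \<beta> \<tau> g h f e +
    Y: lie_module ring_of_type_algebra h Y + universal_module n I B \<beta> \<tau> W
  for n :: nat and I :: "'i set" and B :: "'i \<Rightarrow> 'i \<Rightarrow> 'i set"
    and \<beta> :: "'i \<Rightarrow> 'i \<Rightarrow> 'i \<Rightarrow> 'k::field" and \<tau> :: "nat \<Rightarrow> nat \<Rightarrow> nat \<Rightarrow> 'k"
    and g :: "('k, 'g) lie_algebra" and h :: "('k, 'h) lie_algebra"
    and f :: "'i \<Rightarrow> 'g" and e :: "nat \<Rightarrow> 'h"
    and Y :: "('k, 'h, 'y) lie_module"
    and W :: "(('i, 'k) mpolynomial set, 'x) module"
begin

sublocale T: tensor Y W\<^sub>k
  by (intro tensor.intro Y.M.module_axioms W\<^sub>k.module_axioms)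

abbreviation T :: "('k, ('y \<times> 'x \<Rightarrow>\<^sub>0 'k) set) module"
  where "T \<equiv> tensor_product Y W\<^sub>k"

abbreviation TL :: "('k, 'g, ('y \<times> 'x \<Rightarrow>\<^sub>0 'k) set) lie_module"
  where "TL \<equiv> tensor_lie_module n e g I f B \<beta> \<tau> Y W"

abbreviation D :: "'i \<Rightarrow> ('y \<times> 'x \<Rightarrow>\<^sub>0 'k) set \<Rightarrow> ('y \<times> 'x \<Rightarrow>\<^sub>0 'k) set"
  where "D \<equiv> basis_operator n e I B \<beta> \<tau> Y W"

abbreviation pure :: "'y \<Rightarrow> 'x \<Rightarrow> ('y \<times> 'x \<Rightarrow>\<^sub>0 'k) set"
  where "pure \<equiv> pure_tensor Y W\<^sub>k"

lemma e_act_closed: "\<lbrakk>s \<in> {1..n}; l \<in> carrier Y\<rbrakk> \<Longrightarrow> act Y (e s) l \<in> carrier Y"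
  by (intro Y.act_closed bh.basis_closed)

lemma x_smult_closed: "\<lbrakk>s \<in> {1..n}; i \<in> I; t \<in> carrier W\<rbrakk> \<Longrightarrow> x s i \<odot>\<^bsub>W\<^esub> t \<in> carrier W"
  using module_morphism.hom_closed[OF x_morphism] by simp

lemma pure_closed: "\<lbrakk>l \<in> carrier Y; t \<in> carrier W\<rbrakk> \<Longrightarrow> pure l t \<in> carrier T"
  by (rule T.pure_tensor_closed) simp_all

section \<open>The operators by which basis vectors act, and their commutators\<close>

lemma summand_morphism:
  assumes "s \<in> {1..n}" "i \<in> I"
  shows "module_morphism ring_of_type_algebra T T
    (tensor_map Y W\<^sub>k Y W\<^sub>k (act Y (e s)) ((\<odot>\<^bsub>W\<^esub>) (x s i)))"
  by (rule tensor_map_morphism[OF Y.act_right_morphism[OF bh.basis_closed] x_morphism])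
    (use assms in auto)

lemma D_eq:
  "D i w = (\<Oplus>\<^bsub>T\<^esub>j\<in>{1..n}. tensor_map Y W\<^sub>k Y W\<^sub>k (act Y (e j)) ((\<odot>\<^bsub>W\<^esub>) (x j i)) w)"
  by (simp add: basis_operator_def Let_def)

lemma D_morphism: "i \<in> I \<Longrightarrow> module_morphism ring_of_type_algebra T T (D i)"
  unfolding D_eq[abs_def]
  by (rule module_morphism_finsum) (simp_all add: T.module_axioms summand_morphism)

lemma D_pure:
  assumes "i \<in> I" "l \<in> carrier Y" "t \<in> carrier W"
  shows "D i (pure l t) = (\<Oplus>\<^bsub>T\<^esub>j\<in>{1..n}. pure (act Y (e j) l) (x j i \<odot>\<^bsub>W\<^esub> t))"
  unfolding D_eq
proof (rule T.finsum_eqI)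
  fix j assume j: "j \<in> {1..n}"
  show "tensor_map Y W\<^sub>k Y W\<^sub>k (act Y (e j)) ((\<odot>\<^bsub>W\<^esub>) (x j i)) (pure l t)
      = pure (act Y (e j) l) (x j i \<odot>\<^bsub>W\<^esub> t)"
    by (rule tensor_map_pure[OF Y.act_right_morphism[OF bh.basis_closed[OF j]] x_morphism[OF j assms(1)]])
      (use assms in simp_all)
  show "pure (act Y (e j) l) (x j i \<odot>\<^bsub>W\<^esub> t) \<in> carrier T"
    by (intro pure_closed e_act_closed x_smult_closed assms j)
qed

text \<open>The operator applied last, \<open>D i\<close>, contributes the inner index
  \<open>s\<close>: it expands each summand that \<open>D j\<close> has produced for
  \<open>r\<close>.\<close>

lemma D_D_pure:
  assumes ij: "i \<in> I" "j \<in> I" and lt: "l \<in> carrier Y" "t \<in> carrier W"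
  shows "D i (D j (pure l t)) = (\<Oplus>\<^bsub>T\<^esub>r\<in>{1..n}. \<Oplus>\<^bsub>T\<^esub>s\<in>{1..n}.
    pure (act Y (e s) (act Y (e r) l)) (x s i \<odot>\<^bsub>W\<^esub> (x r j \<odot>\<^bsub>W\<^esub> t)))"
proof -
  have "D i (D j (pure l t)) = (\<Oplus>\<^bsub>T\<^esub>r\<in>{1..n}. D i (pure (act Y (e r) l) (x r j \<odot>\<^bsub>W\<^esub> t)))"
    unfolding D_pure[OF ij(2) lt]
    by (intro module_morphism.hom_finsum[OF D_morphism[OF ij(1)]] finite_atLeastAtMost
        pure_closed e_act_closed x_smult_closed ij lt)
  also have "\<dots> = (\<Oplus>\<^bsub>T\<^esub>r\<in>{1..n}. \<Oplus>\<^bsub>T\<^esub>s\<in>{1..n}.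
      pure (act Y (e s) (act Y (e r) l)) (x s i \<odot>\<^bsub>W\<^esub> (x r j \<odot>\<^bsub>W\<^esub> t)))"
    by (intro T.finsum_eqI D_pure T.finsum_closed funcsetI pure_closed e_act_closed x_smult_closed ij lt)
  finally show ?thesis .
qed

text \<open>Scalars travel between the factors. The \<beta> go into the factor in \<open>W\<close>,
  where \<open>x_relation\<close> trades them for \<tau>; the \<tau> then leave that factor and join
  the e_a, where the sum over \<open>a\<close> is the bracket of e_s and e_r.\<close>

lemma relation_pure:
  assumes ij: "i \<in> I" "j \<in> I" and lt: "l \<in> carrier Y" "t \<in> carrier W"
  shows "(\<Oplus>\<^bsub>T\<^esub>u\<in>B i j. \<beta> i j u \<odot>\<^bsub>T\<^esub> D u (pure l t))
    = (\<Oplus>\<^bsub>T\<^esub>s\<in>{1..n}. \<Oplus>\<^bsub>T\<^esub>r\<in>{1..n}.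
        pure (act Y (bracket h (e s) (e r)) l) (x s i \<odot>\<^bsub>W\<^esub> (x r j \<odot>\<^bsub>W\<^esub> t)))"
proof -
  let ?e = "\<lambda>a. act Y (e a) l" and ?x = "\<lambda>s r. x s i \<odot>\<^bsub>W\<^esub> (x r j \<odot>\<^bsub>W\<^esub> t)"
  note Bij = B[OF ij]
  have u: "u \<in> I" if "u \<in> B i j" for u
    using that Bij by blast
  have x: "?x s r \<in> carrier W" if "s \<in> {1..n}" "r \<in> {1..n}" for s r
    by (intro x_smult_closed ij lt that)
  have smult_W: "c \<odot>\<^bsub>W\<^sub>k\<^esub> w \<in> carrier W" if "w \<in> carrier W" for c w
    using W\<^sub>k.smult_closed[of c w] that by simp
  note closed = pure_closed e_act_closed x_smult_closed T.smult_closed_left smult_W lt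
  note right = T.pure_tensor_right_morphism[OF e_act_closed[OF _ lt(1)]]
  have "(\<Oplus>\<^bsub>T\<^esub>u\<in>B i j. \<beta> i j u \<odot>\<^bsub>T\<^esub> D u (pure l t))
      = (\<Oplus>\<^bsub>T\<^esub>u\<in>B i j. \<Oplus>\<^bsub>T\<^esub>a\<in>{1..n}. pure (?e a) (\<beta> i j u \<odot>\<^bsub>W\<^sub>k\<^esub> (x a u \<odot>\<^bsub>W\<^esub> t)))"
  proof (rule T.finsum_eqI)
    fix u assume "u \<in> B i j"
    note uI = u[OF this]
    have "\<beta> i j u \<odot>\<^bsub>T\<^esub> D u (pure l t)
        = (\<Oplus>\<^bsub>T\<^esub>a\<in>{1..n}. \<beta> i j u \<odot>\<^bsub>T\<^esub> pure (?e a) (x a u \<odot>\<^bsub>W\<^esub> t))"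
      unfolding D_pure[OF uI lt]
      by (rule T.finsum_smult_ldistr) (use uI in \<open>auto intro!: closed\<close>)
    also have "\<dots> = (\<Oplus>\<^bsub>T\<^esub>a\<in>{1..n}. pure (?e a) (\<beta> i j u \<odot>\<^bsub>W\<^sub>k\<^esub> (x a u \<odot>\<^bsub>W\<^esub> t)))"
      \<comment> \<open>The deleted rule would rewrite the field scalar on \<open>W\<^sub>k\<close>
        as the class of a constant polynomial, hiding the bilinearity over the field that is used
        here.\<close>
      by (rule T.finsum_eqI)
        (use uI in \<open>auto intro!: closed T.pure_tensor_smult_right[symmetric] simp del: underlying_space_simps(4)\<close>)
    finally show "\<beta> i j u \<odot>\<^bsub>T\<^esub> D u (pure l t)
        = (\<Oplus>\<^bsub>T\<^esub>a\<in>{1..n}. pure (?e a) (\<beta> i j u \<odot>\<^bsub>W\<^sub>k\<^esub> (x a u \<odot>\<^bsub>W\<^esub> t)))" .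
    show "(\<Oplus>\<^bsub>T\<^esub>a\<in>{1..n}. pure (?e a) (\<beta> i j u \<odot>\<^bsub>W\<^sub>k\<^esub> (x a u \<odot>\<^bsub>W\<^esub> t))) \<in> carrier T"
      by (intro T.finsum_closed funcsetI closed uI)
  qed
  \<comment> \<open>With \<open>a\<close> fixed outside, the sum over \<open>u\<close> can be drawn
    into the argument of the single linear map \<open>pure (?e a)\<close>.\<close>
  also have "\<dots> = (\<Oplus>\<^bsub>T\<^esub>a\<in>{1..n}. \<Oplus>\<^bsub>T\<^esub>u\<in>B i j. pure (?e a) (\<beta> i j u \<odot>\<^bsub>W\<^sub>k\<^esub> (x a u \<odot>\<^bsub>W\<^esub> t)))"
    by (rule T.finsum_swap) (use Bij u in \<open>auto intro!: closed simp del: underlying_space_simps(4)\<close>)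
  also have "\<dots> = (\<Oplus>\<^bsub>T\<^esub>a\<in>{1..n}. \<Oplus>\<^bsub>T\<^esub>s\<in>{1..n}. \<Oplus>\<^bsub>T\<^esub>r\<in>{1..n}.
      pure (?e a) (\<tau> s r a \<odot>\<^bsub>W\<^sub>k\<^esub> ?x s r))"
  proof (rule T.finsum_eqI)
    fix a assume a: "a \<in> {1..n}"
    interpret r: module_morphism ring_of_type_algebra W\<^sub>k T "pure (?e a)"
      by (rule right[OF a])
    have inner: "(\<Oplus>\<^bsub>W\<^sub>k\<^esub>r\<in>{1..n}. \<tau> s r a \<odot>\<^bsub>W\<^sub>k\<^esub> ?x s r) \<in> carrier W\<^sub>k" if "s \<in> {1..n}" for s
      by (rule W\<^sub>k.finsum_closed) (use that in \<open>auto intro!: smult_W x simp del: underlying_space_simps(4)\<close>)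
    have "(\<Oplus>\<^bsub>T\<^esub>u\<in>B i j. pure (?e a) (\<beta> i j u \<odot>\<^bsub>W\<^sub>k\<^esub> (x a u \<odot>\<^bsub>W\<^esub> t)))
        = pure (?e a) (\<Oplus>\<^bsub>W\<^sub>k\<^esub>u\<in>B i j. \<beta> i j u \<odot>\<^bsub>W\<^sub>k\<^esub> (x a u \<odot>\<^bsub>W\<^esub> t))"
      by (rule r.hom_finsum[symmetric])
        (use Bij u a in \<open>auto intro!: closed simp del: underlying_space_simps(4)\<close>)
    also have "\<dots> = pure (?e a) (\<Oplus>\<^bsub>W\<^sub>k\<^esub>s\<in>{1..n}. \<Oplus>\<^bsub>W\<^sub>k\<^esub>r\<in>{1..n}. \<tau> s r a \<odot>\<^bsub>W\<^sub>k\<^esub> ?x s r)"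
      by (simp only: x_relation[OF a ij lt(2)])
    also have "\<dots> = (\<Oplus>\<^bsub>T\<^esub>s\<in>{1..n}. pure (?e a) (\<Oplus>\<^bsub>W\<^sub>k\<^esub>r\<in>{1..n}. \<tau> s r a \<odot>\<^bsub>W\<^sub>k\<^esub> ?x s r))"
      by (intro r.hom_finsum finite_atLeastAtMost inner)
    also have "\<dots> = (\<Oplus>\<^bsub>T\<^esub>s\<in>{1..n}. \<Oplus>\<^bsub>T\<^esub>r\<in>{1..n}. pure (?e a) (\<tau> s r a \<odot>\<^bsub>W\<^sub>k\<^esub> ?x s r))"
    proof (rule T.finsum_eqI)
      fix s assume s: "s \<in> {1..n}"
      show "pure (?e a) (\<Oplus>\<^bsub>W\<^sub>k\<^esub>r\<in>{1..n}. \<tau> s r a \<odot>\<^bsub>W\<^sub>k\<^esub> ?x s r)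
          = (\<Oplus>\<^bsub>T\<^esub>r\<in>{1..n}. pure (?e a) (\<tau> s r a \<odot>\<^bsub>W\<^sub>k\<^esub> ?x s r))"
        by (rule r.hom_finsum) (use s in \<open>auto intro!: smult_W x simp del: underlying_space_simps(4)\<close>)
      show "(\<Oplus>\<^bsub>T\<^esub>r\<in>{1..n}. pure (?e a) (\<tau> s r a \<odot>\<^bsub>W\<^sub>k\<^esub> ?x s r)) \<in> carrier T"
        by (intro T.finsum_closed funcsetI closed x a s)
    qed
    finally show "(\<Oplus>\<^bsub>T\<^esub>u\<in>B i j. pure (?e a) (\<beta> i j u \<odot>\<^bsub>W\<^sub>k\<^esub> (x a u \<odot>\<^bsub>W\<^esub> t)))
        = (\<Oplus>\<^bsub>T\<^esub>s\<in>{1..n}. \<Oplus>\<^bsub>T\<^esub>r\<in>{1..n}. pure (?e a) (\<tau> s r a \<odot>\<^bsub>W\<^sub>k\<^esub> ?x s r))" .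
    show "(\<Oplus>\<^bsub>T\<^esub>s\<in>{1..n}. \<Oplus>\<^bsub>T\<^esub>r\<in>{1..n}. pure (?e a) (\<tau> s r a \<odot>\<^bsub>W\<^sub>k\<^esub> ?x s r)) \<in> carrier T"
      by (intro T.finsum_closed funcsetI closed x a)
  qed
  \<comment> \<open>Two exchanges carry \<open>a\<close> from the outermost to the innermost place,
    where the bracket for fixed \<open>s\<close> and \<open>r\<close> can be assembled.\<close>
  also have "\<dots> = (\<Oplus>\<^bsub>T\<^esub>s\<in>{1..n}. \<Oplus>\<^bsub>T\<^esub>a\<in>{1..n}. \<Oplus>\<^bsub>T\<^esub>r\<in>{1..n}.
      pure (?e a) (\<tau> s r a \<odot>\<^bsub>W\<^sub>k\<^esub> ?x s r))"
    by (intro T.finsum_swap finite_atLeastAtMost T.finsum_closed funcsetI closed x)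
  also have "\<dots> = (\<Oplus>\<^bsub>T\<^esub>s\<in>{1..n}. \<Oplus>\<^bsub>T\<^esub>r\<in>{1..n}. \<Oplus>\<^bsub>T\<^esub>a\<in>{1..n}.
      pure (?e a) (\<tau> s r a \<odot>\<^bsub>W\<^sub>k\<^esub> ?x s r))"
    by (intro T.finsum_eqI T.finsum_swap finite_atLeastAtMost T.finsum_closed funcsetI closed x)
  also have "\<dots> = (\<Oplus>\<^bsub>T\<^esub>s\<in>{1..n}. \<Oplus>\<^bsub>T\<^esub>r\<in>{1..n}.
      pure (act Y (bracket h (e s) (e r)) l) (?x s r))"
  proof (intro T.finsum_eqI T.finsum_closed funcsetI)
    fix s r assume sr: "s \<in> {1..n}" "r \<in> {1..n}"
    interpret a: module_morphism ring_of_type_algebra h Y "\<lambda>z. act Y z l"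
      by (rule Y.act_left_morphism[OF lt(1)])
    interpret p: module_morphism ring_of_type_algebra Y T "\<lambda>l. pure l (?x s r)"
      by (rule T.pure_tensor_left_morphism) (use x[OF sr] in simp)
    have "act Y (bracket h (e s) (e r)) l = (\<Oplus>\<^bsub>Y\<^esub>a\<in>{1..n}. act Y (\<tau> s r a \<odot>\<^bsub>h\<^esub> e a) l)"
      unfolding bracket_h[OF sr] by (rule a.hom_finsum) (simp_all add: bh.basis_closed)
    then have "pure (act Y (bracket h (e s) (e r)) l) (?x s r)
        = pure (\<Oplus>\<^bsub>Y\<^esub>a\<in>{1..n}. act Y (\<tau> s r a \<odot>\<^bsub>h\<^esub> e a) l) (?x s r)"
      by (rule arg_cong)
    also have "\<dots> = (\<Oplus>\<^bsub>T\<^esub>a\<in>{1..n}. pure (act Y (\<tau> s r a \<odot>\<^bsub>h\<^esub> e a) l) (?x s r))"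
      by (rule p.hom_finsum) (simp_all add: a.hom_closed bh.basis_closed)
    also have "\<dots> = (\<Oplus>\<^bsub>T\<^esub>a\<in>{1..n}. pure (?e a) (\<tau> s r a \<odot>\<^bsub>W\<^sub>k\<^esub> ?x s r))"
    proof (rule T.finsum_eqI)
      fix a assume a: "a \<in> {1..n}"
      show "pure (act Y (\<tau> s r a \<odot>\<^bsub>h\<^esub> e a) l) (?x s r) = pure (?e a) (\<tau> s r a \<odot>\<^bsub>W\<^sub>k\<^esub> ?x s r)"
        using a x[OF sr] e_act_closed[OF a lt(1)]
        by (simp add: a.hom_smult bh.basis_closed p.hom_smult T.pure_tensor_smult_right
            del: underlying_space_simps(4))
      show "pure (?e a) (\<tau> s r a \<odot>\<^bsub>W\<^sub>k\<^esub> ?x s r) \<in> carrier T"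
        by (intro closed x a sr)
    qed
    finally show "(\<Oplus>\<^bsub>T\<^esub>a\<in>{1..n}. pure (?e a) (\<tau> s r a \<odot>\<^bsub>W\<^sub>k\<^esub> ?x s r))
        = pure (act Y (bracket h (e s) (e r)) l) (?x s r)" ..
    show "pure (act Y (bracket h (e s) (e r)) l) (?x s r) \<in> carrier T"
      by (intro pure_closed x sr a.hom_closed h.bracket_closed bh.basis_closed)
    \<comment> \<open>The same membership is asked for twice, by the inner congruence and by closure
      of the outer summands.\<close>
    then show "pure (act Y (bracket h (e s) (e r)) l) (?x s r) \<in> carrier T" .
  qed
  finally show ?thesis .
qed

lemma D_commutator_pure:
  assumes ij: "i \<in> I" "j \<in> I" and lt: "l \<in> carrier Y" "t \<in> carrier W"
  shows "(\<Oplus>\<^bsub>T\<^esub>u\<in>B i j. \<beta> i j u \<odot>\<^bsub>T\<^esub> D u (pure l t))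
    = D i (D j (pure l t)) \<ominus>\<^bsub>T\<^esub> D j (D i (pure l t))"
proof -
  let ?x = "\<lambda>s r. x s i \<odot>\<^bsub>W\<^esub> (x r j \<odot>\<^bsub>W\<^esub> t)"
  let ?F = "\<lambda>s r. pure (act Y (e s) (act Y (e r) l)) (?x s r)"
  let ?G = "\<lambda>s r. pure (act Y (e r) (act Y (e s) l)) (?x s r)"
  have closed: "?F s r \<in> carrier T" "?G s r \<in> carrier T" if "s \<in> {1..n}" "r \<in> {1..n}" for s r
    by (intro pure_closed e_act_closed x_smult_closed ij lt that)+
  have split: "pure (act Y (bracket h (e s) (e r)) l) (?x s r) = ?F s r \<ominus>\<^bsub>T\<^esub> ?G s r"
    if sr: "s \<in> {1..n}" "r \<in> {1..n}" for s r
  proof -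
    interpret p: module_morphism ring_of_type_algebra Y T "\<lambda>l. pure l (?x s r)"
      by (rule T.pure_tensor_left_morphism) (use x_smult_closed ij lt sr in simp)
    show ?thesis
      using sr lt by (simp add: Y.act_bracket bh.basis_closed p.hom_minus e_act_closed)
  qed
  have "(\<Oplus>\<^bsub>T\<^esub>u\<in>B i j. \<beta> i j u \<odot>\<^bsub>T\<^esub> D u (pure l t))
      = (\<Oplus>\<^bsub>T\<^esub>s\<in>{1..n}. \<Oplus>\<^bsub>T\<^esub>r\<in>{1..n}. ?F s r \<ominus>\<^bsub>T\<^esub> ?G s r)"
    unfolding relation_pure[OF assms]
    by (intro T.finsum_eqI split T.finsum_closed funcsetI T.minus_closed closed)
  also have "\<dots> = (\<Oplus>\<^bsub>T\<^esub>s\<in>{1..n}. (\<Oplus>\<^bsub>T\<^esub>r\<in>{1..n}. ?F s r) \<ominus>\<^bsub>T\<^esub> (\<Oplus>\<^bsub>T\<^esub>r\<in>{1..n}. ?G s r))"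
    by (intro T.finsum_eqI T.finsum_diff T.minus_closed T.finsum_closed funcsetI closed
        finite_atLeastAtMost)
  also have "\<dots> = (\<Oplus>\<^bsub>T\<^esub>s\<in>{1..n}. \<Oplus>\<^bsub>T\<^esub>r\<in>{1..n}. ?F s r) \<ominus>\<^bsub>T\<^esub> (\<Oplus>\<^bsub>T\<^esub>s\<in>{1..n}. \<Oplus>\<^bsub>T\<^esub>r\<in>{1..n}. ?G s r)"
    by (intro T.finsum_diff T.finsum_closed funcsetI closed finite_atLeastAtMost)
  \<comment> \<open>In \<open>D_D_pure\<close> the index of the operator applied last is innermost,
    here \<open>s\<close>; hence the exchange of sums.\<close>
  also have "(\<Oplus>\<^bsub>T\<^esub>s\<in>{1..n}. \<Oplus>\<^bsub>T\<^esub>r\<in>{1..n}. ?F s r) = D i (D j (pure l t))"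
    unfolding D_D_pure[OF ij lt] by (intro T.finsum_swap closed finite_atLeastAtMost)
  \<comment> \<open>Here \<open>r\<close> belongs to the operator applied last and is already
    innermost; only the two generators in the \<open>W\<close> factor have to change places.\<close>
  also have "(\<Oplus>\<^bsub>T\<^esub>s\<in>{1..n}. \<Oplus>\<^bsub>T\<^esub>r\<in>{1..n}. ?G s r) = D j (D i (pure l t))"
    unfolding D_D_pure[OF ij(2,1) lt]
  proof (intro T.finsum_eqI T.finsum_closed funcsetI)
    fix s r assume sr: "s \<in> {1..n}" "r \<in> {1..n}"
    show "?G s r = pure (act Y (e r) (act Y (e s) l)) (x r j \<odot>\<^bsub>W\<^esub> (x s i \<odot>\<^bsub>W\<^esub> t))"
      by (simp only: x_commute[OF sr(1) ij(1) sr(2) ij(2) lt(2)])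
    show "pure (act Y (e r) (act Y (e s) l)) (x r j \<odot>\<^bsub>W\<^esub> (x s i \<odot>\<^bsub>W\<^esub> t)) \<in> carrier T"
      by (intro pure_closed e_act_closed x_smult_closed ij lt sr)
    then show "pure (act Y (e r) (act Y (e s) l)) (x r j \<odot>\<^bsub>W\<^esub> (x s i \<odot>\<^bsub>W\<^esub> t)) \<in> carrier T" .
  qed
  finally show ?thesis .
qed

lemma D_commutator:
  assumes ij: "i \<in> I" "j \<in> I" and w: "w \<in> carrier T"
  shows "(\<Oplus>\<^bsub>T\<^esub>u\<in>B i j. \<beta> i j u \<odot>\<^bsub>T\<^esub> D u w) = D i (D j w) \<ominus>\<^bsub>T\<^esub> D j (D i w)"
proof (rule T.morphism_eqI[OF _ _ _ w])
  show "module_morphism ring_of_type_algebra T T (\<lambda>w. \<Oplus>\<^bsub>T\<^esub>u\<in>B i j. \<beta> i j u \<odot>\<^bsub>T\<^esub> D u w)"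
  proof (rule module_morphism_finsum[OF T.module_axioms T.module_axioms])
    fix u assume "u \<in> B i j"
    then have "u \<in> I" using B[OF ij] by blast
    then show "module_morphism ring_of_type_algebra T T (\<lambda>w. \<beta> i j u \<odot>\<^bsub>T\<^esub> D u w)"
      by (intro module_morphism_comp[OF D_morphism T.module_morphism_smult]) simp_all
  qed (use B[OF ij] in simp)
  show "module_morphism ring_of_type_algebra T T (\<lambda>w. D i (D j w) \<ominus>\<^bsub>T\<^esub> D j (D i w))"
    by (intro module_morphism_minus module_morphism_comp[OF D_morphism D_morphism] ij)
qed (use ij in \<open>simp add: D_commutator_pure\<close>)

section \<open>From basis vectors to the whole Lie algebra\<close>

lemma TL_simps [simp]:
  "carrier TL = carrier T" "\<zero>\<^bsub>TL\<^esub> = \<zero>\<^bsub>T\<^esub>" "add TL = add T" "module.smult TL = module.smult T"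
  by (simp_all add: tensor_lie_module_def Let_def)

text \<open>Inverses depend on the record only through its carrier, zero and addition, which
  \<open>TL\<close> shares with \<open>T\<close>; finite sums behave alike.\<close>

lemma TL_a_minus [simp]: "v \<ominus>\<^bsub>TL\<^esub> w = v \<ominus>\<^bsub>T\<^esub> w"
  by (simp add: a_minus_def a_inv_def m_inv_def)

lemma TL_finsum [simp]: "finsum TL F S = finsum T F S"
  by (simp add: finsum_def finprod_def)

lemma TL_module: "module ring_of_type_algebra TL"
proof (rule moduleI)
  show "abelian_group TL"
    by (rule abelian_groupI) (use T.l_neg in \<open>auto simp: T.a_ac\<close>)
qed (auto simp: T.smult_l_distr T.smult_r_distr T.smult_assoc1 T.smult_one[simplified]
    simp del: type_ring_simps)

text \<open>Exhibits the action, for fixed \<open>w\<close>, as coordinates followed by a linear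
  combination of the vectors \<open>D i w\<close>, a composite of two linear maps in
  \<open>z\<close>.\<close>

lemma TL_act: "act TL z w = linear_combination T (\<lambda>i. D i w) (coordinates g I f z)"
  by (simp add: tensor_lie_module_def Let_def linear_combination_def)

lemma TL_act_left_morphism:
  assumes "w \<in> carrier T"
  shows "module_morphism ring_of_type_algebra g T (\<lambda>z. act TL z w)"
  unfolding TL_act
proof (rule module_morphism_comp[OF bg.coordinates_morphism linear_combination_morphism])
  show "(\<lambda>i. D i w) \<in> I \<rightarrow> carrier T"
    using assms module_morphism.hom_closed[OF D_morphism] by blast
qed (rule T.module_axioms)

lemma TL_act_right_morphism:
  assumes "z \<in> carrier g"
  shows "module_morphism ring_of_type_algebra T T (act TL z)"
  unfolding TL_act[abs_def] linear_combination_def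
proof (rule module_morphism_finsum[OF T.module_axioms T.module_axioms])
  fix i assume "i \<in> Poly_Mapping.keys (coordinates g I f z)"
  then have "i \<in> I" using bg.keys_coordinates[OF assms] by blast
  then show "module_morphism ring_of_type_algebra T T
      (\<lambda>w. Poly_Mapping.lookup (coordinates g I f z) i \<odot>\<^bsub>T\<^esub> D i w)"
    by (intro module_morphism_comp[OF D_morphism T.module_morphism_smult]) simp_all
qed simp

lemma TL_act_closed: "\<lbrakk>z \<in> carrier g; w \<in> carrier T\<rbrakk> \<Longrightarrow> act TL z w \<in> carrier T"
  by (rule module_morphism.hom_closed[OF TL_act_right_morphism])

lemma TL_act_basis:
  assumes "i \<in> I" "w \<in> carrier T"
  shows "act TL (f i) w = D i w"
  unfolding TL_act bg.coordinates_basis[OF assms(1)]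
  by (rule linear_combination_single[OF T.module_axioms])
    (rule module_morphism.hom_closed[OF D_morphism[OF assms(1)] assms(2)])

lemma TL_act_bracket_basis:
  assumes ij: "i \<in> I" "j \<in> I" and w: "w \<in> carrier T"
  shows "act TL (bracket g (f i) (f j)) w
    = act TL (f i) (act TL (f j) w) \<ominus>\<^bsub>T\<^esub> act TL (f j) (act TL (f i) w)"
proof -
  interpret a: module_morphism ring_of_type_algebra g T "\<lambda>z. act TL z w"
    by (rule TL_act_left_morphism[OF w])
  note Bij = B[OF ij]
  have D_closed: "D u w \<in> carrier T" if "u \<in> I" for u
    by (rule module_morphism.hom_closed[OF D_morphism[OF that] w])
  have "act TL (bracket g (f i) (f j)) w = (\<Oplus>\<^bsub>T\<^esub>u\<in>B i j. act TL (\<beta> i j u \<odot>\<^bsub>g\<^esub> f u) w)"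
    unfolding bracket_g[OF ij]
    by (rule a.hom_finsum) (use Bij bg.basis_closed in auto)
  also have "\<dots> = (\<Oplus>\<^bsub>T\<^esub>u\<in>B i j. \<beta> i j u \<odot>\<^bsub>T\<^esub> D u w)"
  proof (rule T.finsum_eqI)
    fix u assume "u \<in> B i j"
    then have u: "u \<in> I" using Bij by blast
    show "act TL (\<beta> i j u \<odot>\<^bsub>g\<^esub> f u) w = \<beta> i j u \<odot>\<^bsub>T\<^esub> D u w"
      using u by (simp add: a.hom_smult bg.basis_closed TL_act_basis w)
    show "\<beta> i j u \<odot>\<^bsub>T\<^esub> D u w \<in> carrier T"
      using D_closed[OF u] by simp
  qed
  also have "\<dots> = act TL (f i) (act TL (f j) w) \<ominus>\<^bsub>T\<^esub> act TL (f j) (act TL (f i) w)"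
    using ij w by (simp add: D_commutator TL_act_basis D_closed)
  finally show ?thesis .
qed

text \<open>Both sides are linear in each Lie algebra argument separately, so the identity extends
  from pairs of basis vectors one argument at a time: the second with \<open>f i\<close> held fixed,
  the other with \<open>z'\<close> held fixed.\<close>

lemma TL_act_bracket:
  assumes z: "z \<in> carrier g" "z' \<in> carrier g" and w: "w \<in> carrier T"
  shows "act TL (bracket g z z') w = act TL z (act TL z' w) \<ominus>\<^bsub>T\<^esub> act TL z' (act TL z w)"
proof -
  have basis: "act TL (bracket g (f i) v) w
      = act TL (f i) (act TL v w) \<ominus>\<^bsub>T\<^esub> act TL v (act TL (f i) w)"
    if i: "i \<in> I" and v: "v \<in> carrier g" for i v
  proof (rule bg.morphism_eqI[OF _ _ _ v])
    note fi = bg.basis_closed[OF i]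
    show "module_morphism ring_of_type_algebra g T (\<lambda>v. act TL (bracket g (f i) v) w)"
      by (intro module_morphism_comp[OF g.bracket_right_morphism TL_act_left_morphism] fi w)
    show "module_morphism ring_of_type_algebra g T
        (\<lambda>v. act TL (f i) (act TL v w) \<ominus>\<^bsub>T\<^esub> act TL v (act TL (f i) w))"
      by (intro module_morphism_minus TL_act_left_morphism TL_act_closed fi w
          module_morphism_comp[OF TL_act_left_morphism[OF w] TL_act_right_morphism[OF fi]])
  qed (rule TL_act_bracket_basis[OF i _ w])
  show ?thesis
  proof (rule bg.morphism_eqI[OF _ _ _ z(1)])
    show "module_morphism ring_of_type_algebra g T (\<lambda>z. act TL (bracket g z z') w)"
      by (intro module_morphism_comp[OF g.bracket_left_morphism TL_act_left_morphism] z w)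
    show "module_morphism ring_of_type_algebra g T
        (\<lambda>z. act TL z (act TL z' w) \<ominus>\<^bsub>T\<^esub> act TL z' (act TL z w))"
      by (intro module_morphism_minus TL_act_left_morphism TL_act_closed z w
          module_morphism_comp[OF TL_act_left_morphism[OF w] TL_act_right_morphism[OF z(2)]])
  qed (rule basis[OF _ z(2)])
qed

lemma TL_lie_module: "lie_module ring_of_type_algebra g TL"
proof (intro lie_module.intro lie_module_axioms.intro g.lie_algebra_axioms TL_module)
  fix z z' w assume z: "z \<in> carrier g" "z' \<in> carrier g" and "w \<in> carrier TL"
  then have w: "w \<in> carrier T" by simp
  show "act TL (bracket g z z') w = act TL z (act TL z' w) \<ominus>\<^bsub>TL\<^esub> act TL z' (act TL z w)"
    using TL_act_bracket[OF z w] by simp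
  show "act TL (z \<oplus>\<^bsub>g\<^esub> z') w = act TL z w \<oplus>\<^bsub>TL\<^esub> act TL z' w"
    using module_morphism.hom_add[OF TL_act_left_morphism[OF w] z] by simp
next
  fix a :: 'k and z w assume az: "a \<in> carrier ring_of_type_algebra" "z \<in> carrier g" and "w \<in> carrier TL"
  then have w: "w \<in> carrier T" by simp
  show "act TL (a \<odot>\<^bsub>g\<^esub> z) w = a \<odot>\<^bsub>TL\<^esub> act TL z w"
    using module_morphism.hom_smult[OF TL_act_left_morphism[OF w] az] by simp
  show "act TL z (a \<odot>\<^bsub>TL\<^esub> w) = a \<odot>\<^bsub>TL\<^esub> act TL z w"
    using module_morphism.hom_smult[OF TL_act_right_morphism[OF az(2)] az(1) w] by simp
next
  fix z v w assume z: "z \<in> carrier g" and vw: "v \<in> carrier TL" "w \<in> carrier TL"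
  show "act TL z (v \<oplus>\<^bsub>TL\<^esub> w) = act TL z v \<oplus>\<^bsub>TL\<^esub> act TL z w"
    using module_morphism.hom_add[OF TL_act_right_morphism[OF z], of v w] vw by simp
qed (simp add: TL_act_closed)

end

section \<open>Functoriality\<close>

text \<open>The unit and associativity laws are equalities of total functions. They hold because
  morphisms are extensional and identities and composites are restricted to the carrier of their
  source.\<close>

lemma module_category_category:
  fixes R :: "('a, 'r) ring_scheme"
  shows "category (module_category R :: (('a, 'c) module, 'c \<Rightarrow> 'c) category)"
proof
  fix L M N :: "('a, 'c) module" and \<phi> \<psi> :: "'c \<Rightarrow> 'c"
  assume obj: "L \<in> Obj (module_category R)" "M \<in> Obj (module_category R)" "N \<in> Obj (module_category R)"
    and hom: "\<phi> \<in> Hom (module_category R) L M" "\<psi> \<in> Hom (module_category R) M N"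
  \<comment> \<open>A composite is evaluated at sums and multiples, which must be known to lie in
    the source carrier.\<close>
  then have "module R L"
    by (simp add: module_category_def)
  then interpret L: module R L .
  show "Comp (module_category R) L M N \<psi> \<phi> \<in> Hom (module_category R) L N"
    using hom by (auto simp: module_category_def linear_maps_def compose_eq funcset_compose PiE_def Pi_iff)
next
  fix M :: "('a, 'c) module"
  assume "M \<in> Obj (module_category R)"
  then have "module R M"
    by (simp add: module_category_def)
  then interpret M: module R M .
  show "Ident (module_category R) M \<in> Hom (module_category R) M M"
    by (auto simp: module_category_def linear_maps_def)
qed (auto simp: module_category_def linear_maps_def PiE_def compose_def extensional_def fun_eq_iff Pi_iff)

lemma lie_module_category_category:
  fixes K :: "('a, 'r) ring_scheme" and L :: "('a, 'c, 'p) lie_algebra_scheme"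
  shows "category (lie_module_category K L :: (('a, 'c, 'd) lie_module, 'd \<Rightarrow> 'd) category)"
proof
  fix M N P :: "('a, 'c, 'd) lie_module" and \<phi> \<psi> :: "'d \<Rightarrow> 'd"
  assume "M \<in> Obj (lie_module_category K L)"
    and hom: "\<phi> \<in> Hom (lie_module_category K L) M N" "\<psi> \<in> Hom (lie_module_category K L) N P"
  then have "lie_module K L M"
    by (simp add: lie_module_category_def)
  then interpret M: lie_module K L M .
  show "Comp (lie_module_category K L) M N P \<psi> \<phi> \<in> Hom (lie_module_category K L) M P"
    using hom by (auto simp: lie_module_category_def lie_module_maps_def linear_maps_def compose_eq
        PiE_def Pi_iff M.act_closed)
next
  fix M :: "('a, 'c, 'd) lie_module"
  assume "M \<in> Obj (lie_module_category K L)"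
  then have "lie_module K L M"
    by (simp add: lie_module_category_def)
  then interpret M: lie_module K L M .
  show "Ident (lie_module_category K L) M \<in> Hom (lie_module_category K L) M M"
    by (auto simp: lie_module_category_def lie_module_maps_def linear_maps_def M.act_closed)
qed (auto simp: lie_module_category_def lie_module_maps_def linear_maps_def PiE_def compose_def
    extensional_def fun_eq_iff Pi_iff)

section \<open>Identities and composites of tensor maps\<close>

lemma tensor_map_extensional:
  "tensor_map M N M' N' \<phi> \<psi> \<in> extensional (carrier (tensor_product M N))"
  by (simp add: tensor_map_def)

text \<open>Agreement with the identity is asked for on the carriers only, which covers both
  \<open>id\<close> and the restricted identities of the categories.\<close>

lemma tensor_map_ident:
  assumes "module ring_of_type_algebra M" "module ring_of_type_algebra N"
    and "\<And>x. x \<in> carrier M \<Longrightarrow> \<phi> x = x" "\<And>y. y \<in> carrier N \<Longrightarrow> \<psi> y = y"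
  shows "tensor_map M N M N \<phi> \<psi> = (\<lambda>w\<in>carrier (tensor_product M N). w)"
proof (rule extensionalityI[OF tensor_map_extensional restrict_extensional])
  interpret tensor M N
    by (intro tensor.intro assms)
  fix w assume w: "w \<in> carrier (tensor_product M N)"
  have \<phi>: "module_morphism ring_of_type_algebra M M \<phi>"
    and \<psi>: "module_morphism ring_of_type_algebra N N \<psi>"
    by (rule module_morphism_cong[OF M.module_morphism_id], simp add: assms(3))
      (rule module_morphism_cong[OF N.module_morphism_id], simp add: assms(4))
  have "tensor_map M N M N \<phi> \<psi> w = id w"
    by (rule morphism_eqI[OF tensor_map_morphism[OF \<phi> \<psi>] module_morphism_id _ w])
      (simp add: tensor_map_pure[OF \<phi> \<psi>] assms(3,4))
  with w show "tensor_map M N M N \<phi> \<psi> w = (\<lambda>w\<in>carrier (tensor_product M N). w) w"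
    by simp
qed

text \<open>\<phi>'' and \<psi>'' are tied to the composites only on the carriers, so one of them
  may be a categorical \<open>compose\<close> and the other a plain \<open>id\<close>.\<close>

lemma tensor_map_compose:
  assumes \<phi>: "module_morphism ring_of_type_algebra M M' \<phi>"
    and \<psi>: "module_morphism ring_of_type_algebra N N' \<psi>"
    and \<phi>': "module_morphism ring_of_type_algebra M' M'' \<phi>'"
    and \<psi>': "module_morphism ring_of_type_algebra N' N'' \<psi>'"
    and eq: "\<And>x. x \<in> carrier M \<Longrightarrow> \<phi>'' x = \<phi>' (\<phi> x)" "\<And>y. y \<in> carrier N \<Longrightarrow> \<psi>'' y = \<psi>' (\<psi> y)"
  shows "tensor_map M N M'' N'' \<phi>'' \<psi>''
    = compose (carrier (tensor_product M N)) (tensor_map M' N' M'' N'' \<phi>' \<psi>') (tensor_map M N M' N' \<phi> \<psi>)"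
proof (rule extensionalityI[OF tensor_map_extensional compose_extensional])
  interpret \<phi>: module_morphism ring_of_type_algebra M M' \<phi> by fact
  interpret \<psi>: module_morphism ring_of_type_algebra N N' \<psi> by fact
  interpret tensor M N ..
  fix w assume w: "w \<in> carrier (tensor_product M N)"
  have \<phi>'': "module_morphism ring_of_type_algebra M M'' \<phi>''"
    by (rule module_morphism_cong[OF module_morphism_comp[OF \<phi> \<phi>'] eq(1)])
  have \<psi>'': "module_morphism ring_of_type_algebra N N'' \<psi>''"
    by (rule module_morphism_cong[OF module_morphism_comp[OF \<psi> \<psi>'] eq(2)])
  have "tensor_map M N M'' N'' \<phi>'' \<psi>'' w
      = tensor_map M' N' M'' N'' \<phi>' \<psi>' (tensor_map M N M' N' \<phi> \<psi> w)"
    by (rule morphism_eqI[OF tensor_map_morphism[OF \<phi>'' \<psi>'']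
          module_morphism_comp[OF tensor_map_morphism[OF \<phi> \<psi>] tensor_map_morphism[OF \<phi>' \<psi>']] _ w])
      (simp add: tensor_map_pure[OF \<phi> \<psi>] tensor_map_pure[OF \<phi>' \<psi>'] tensor_map_pure[OF \<phi>'' \<psi>'']
        eq \<phi>.hom_closed \<psi>.hom_closed)
  with w show "tensor_map M N M'' N'' \<phi>'' \<psi>'' w = compose (carrier (tensor_product M N))
      (tensor_map M' N' M'' N'' \<phi>' \<psi>') (tensor_map M N M' N' \<phi> \<psi>) w"
    by (simp add: compose_eq)
qed

context universal_algebra_data
begin

text \<open>The field acts through the universal algebra on both sides, so a map linear over that
  algebra is linear over the field.\<close>

lemma underlying_morphism:
  assumes "module_morphism A W W' \<psi>"
  shows "module_morphism ring_of_type_algebra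
    (underlying_space n I B \<beta> \<tau> W) (underlying_space n I B \<beta> \<tau> W') \<psi>"
proof -
  interpret \<psi>: module_morphism A W W' \<psi> by fact
  interpret W: universal_module n I B \<beta> \<tau> W ..
  interpret W': universal_module n I B \<beta> \<tau> W' ..
  show ?thesis
    by unfold_locales
      (simp_all add: \<psi>.hom_closed \<psi>.hom_add \<psi>.hom_smult W.cls.hom_closed poly_const_closed
        del: poly_ring_simps)
qed

end

context lie_algebra_pair
begin

text \<open>Both functors draw their morphisms from here, one with \<phi> the identity, the other
  with \<psi> the identity. On pure tensors \<phi> commutes with each e_j and \<psi> with each x_ji,
  hence the map intertwines the operators of the basis vectors.\<close>

lemma tensor_map_lie_module_map:
  assumes Y: "lie_module ring_of_type_algebra h Y" and Y': "lie_module ring_of_type_algebra h Y'"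
    and W: "module A W" and W': "module A W'"
    and \<phi>: "module_morphism ring_of_type_algebra Y Y' \<phi>"
    and \<phi>_act: "\<And>z l. \<lbrakk>z \<in> carrier h; l \<in> carrier Y\<rbrakk> \<Longrightarrow> \<phi> (act Y z l) = act Y' z (\<phi> l)"
    and \<psi>: "module_morphism A W W' \<psi>"
  shows "tensor_map Y (underlying_space n I B \<beta> \<tau> W) Y' (underlying_space n I B \<beta> \<tau> W') \<phi> \<psi>
    \<in> lie_module_maps ring_of_type_algebra g
        (tensor_lie_module n e g I f B \<beta> \<tau> Y W) (tensor_lie_module n e g I f B \<beta> \<tau> Y' W')"
proof -
  interpret Y: lie_module ring_of_type_algebra h Y by fact
  interpret Y': lie_module ring_of_type_algebra h Y' by fact
  interpret W: module A W by fact
  interpret W': module A W' by fact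
  interpret S: tensor_action n I B \<beta> \<tau> g h f e Y W ..
  interpret S': tensor_action n I B \<beta> \<tau> g h f e Y' W' ..
  interpret \<phi>: module_morphism ring_of_type_algebra Y Y' \<phi> by fact
  interpret \<psi>: module_morphism A W W' \<psi> by fact
  note \<psi>k = underlying_morphism[OF \<psi>]
  let ?F = "tensor_map Y S.W\<^sub>k Y' S'.W\<^sub>k \<phi> \<psi>"
  have F: "module_morphism ring_of_type_algebra S.T S'.T ?F"
    by (rule tensor_map_morphism[OF \<phi> \<psi>k])
  interpret F: module_morphism ring_of_type_algebra S.T S'.T ?F by (rule F)
  note F_pure = tensor_map_pure[OF \<phi> \<psi>k]
  have F_D: "?F (S.D i w) = S'.D i (?F w)" if i: "i \<in> I" and w: "w \<in> carrier S.T" for i w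
  proof (rule S.T.morphism_eqI[OF module_morphism_comp[OF S.D_morphism[OF i] F]
        module_morphism_comp[OF F S'.D_morphism[OF i]] _ w])
    fix l t assume l: "l \<in> carrier Y" and "t \<in> carrier S.W\<^sub>k"
    then have t: "t \<in> carrier W" by simp
    have "?F (S.D i (S.pure l t))
        = (\<Oplus>\<^bsub>S'.T\<^esub>j\<in>{1..n}. ?F (S.pure (act Y (e j) l) (x j i \<odot>\<^bsub>W\<^esub> t)))"
      unfolding S.D_pure[OF i l t]
      by (intro F.hom_finsum finite_atLeastAtMost S.pure_closed S.e_act_closed S.x_smult_closed i l t)
    also have "\<dots> = (\<Oplus>\<^bsub>S'.T\<^esub>j\<in>{1..n}. S'.pure (act Y' (e j) (\<phi> l)) (x j i \<odot>\<^bsub>W'\<^esub> \<psi> t))"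
    proof (rule S'.T.finsum_eqI)
      fix j assume j: "j \<in> {1..n}"
      have "x j i \<in> carrier A"
        unfolding universal_gen_def by (intro S.cls.hom_closed poly_var_closed i j)
      then show "?F (S.pure (act Y (e j) l) (x j i \<odot>\<^bsub>W\<^esub> t))
          = S'.pure (act Y' (e j) (\<phi> l)) (x j i \<odot>\<^bsub>W'\<^esub> \<psi> t)"
        using j l t by (simp add: F_pure S.e_act_closed S.x_smult_closed i \<phi>_act bh.basis_closed \<psi>.hom_smult)
      show "S'.pure (act Y' (e j) (\<phi> l)) (x j i \<odot>\<^bsub>W'\<^esub> \<psi> t) \<in> carrier S'.T"
        by (intro S'.pure_closed S'.e_act_closed S'.x_smult_closed i j \<phi>.hom_closed \<psi>.hom_closed l t)
    qed
    also have "\<dots> = S'.D i (?F (S.pure l t))"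
      using l t by (simp add: F_pure S'.D_pure[OF i] \<phi>.hom_closed \<psi>.hom_closed)
    finally show "?F (S.D i (S.pure l t)) = S'.D i (?F (S.pure l t))" .
  qed
  \<comment> \<open>For fixed \<open>w\<close> both sides are linear in \<open>z\<close>, and on the
    basis \<open>f\<close> the equation is \<open>F_D\<close>.\<close>
  have "?F (act S.TL z w) = act S'.TL z (?F w)" if z: "z \<in> carrier g" and w: "w \<in> carrier S.T" for z w
    by (rule bg.morphism_eqI[OF module_morphism_comp[OF S.TL_act_left_morphism[OF w] F]
          S'.TL_act_left_morphism[OF F.hom_closed[OF w]] _ z])
      (simp add: S.TL_act_basis S'.TL_act_basis F_D w F.hom_closed)
  \<comment> \<open>Linearity is known for the plain tensor products; the Lie module records have
    the same carrier, addition and scalar multiplication.\<close>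
  moreover have "?F \<in> linear_maps ring_of_type_algebra S.TL S'.TL"
    using F tensor_map_extensional[of Y S.W\<^sub>k Y' S'.W\<^sub>k \<phi> \<psi>]
      linear_maps_iff[OF S.T.module_axioms S'.T.module_axioms, of ?F]
    by (simp add: linear_maps_def)
  ultimately show ?thesis
    by (simp add: lie_module_maps_def)
qed

lemma tensor_functor_right:
  fixes U :: "('k, 'h, 'u) lie_module"
  assumes U: "lie_module ring_of_type_algebra h U"
  shows "category_functor
    (module_category A :: ((('i, 'k) mpolynomial set, 'x) module, 'x \<Rightarrow> 'x) category)
    (lie_module_category ring_of_type_algebra g)
    (\<lambda>W. tensor_lie_module n e g I f B \<beta> \<tau> U W)
    (\<lambda>W W' \<phi>. tensor_map U (underlying_space n I B \<beta> \<tau> W) U (underlying_space n I B \<beta> \<tau> W') id \<phi>)"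
proof (intro category_functor.intro module_category_category lie_module_category_category
    category_functor_axioms.intro)
  interpret U: lie_module ring_of_type_algebra h U by fact
  have action: "tensor_action n I B \<beta> \<tau> g h f e U Q" if "module A Q" for Q
    using that by (intro tensor_action.intro lie_algebra_pair_axioms U universal_module.intro
        universal_algebra_data_axioms)
  note defs = module_category_def lie_module_category_def
  fix Q :: "(('i, 'k) mpolynomial set, 'x) module"
  assume "Q \<in> Obj (module_category A)"
  then have Q: "module A Q" by (simp add: defs)
  interpret Q: tensor_action n I B \<beta> \<tau> g h f e U Q by (rule action[OF Q])
  show "tensor_lie_module n e g I f B \<beta> \<tau> U Q \<in> Obj (lie_module_category ring_of_type_algebra g)"
    by (simp add: defs Q.TL_lie_module)
  show "tensor_map U Q.W\<^sub>k U Q.W\<^sub>k id (Ident (module_category A) Q)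
      = Ident (lie_module_category ring_of_type_algebra g) Q.TL"
    using tensor_map_ident[OF U.M.module_axioms Q.W\<^sub>k.module_axioms, of id "\<lambda>w\<in>carrier Q. w"]
    by (simp add: defs)
  fix R \<phi> assume "R \<in> Obj (module_category A)" "\<phi> \<in> Hom (module_category A) Q R"
  then have R: "module A R" and \<phi>: "module_morphism A Q R \<phi>"
    using linear_maps_iff[OF Q] by (auto simp: defs)
  show "tensor_map U (underlying_space n I B \<beta> \<tau> Q) U (underlying_space n I B \<beta> \<tau> R) id \<phi>
      \<in> Hom (lie_module_category ring_of_type_algebra g)
        (tensor_lie_module n e g I f B \<beta> \<tau> U Q) (tensor_lie_module n e g I f B \<beta> \<tau> U R)"
    using tensor_map_lie_module_map[OF U U Q R U.M.module_morphism_id _ \<phi>] by (simp add: defs)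
  fix S \<psi> assume "S \<in> Obj (module_category A)" "\<psi> \<in> Hom (module_category A) R S"
  then have \<psi>: "module_morphism A R S \<psi>"
    using linear_maps_iff[OF R] by (auto simp: defs)
  show "tensor_map U (underlying_space n I B \<beta> \<tau> Q) U (underlying_space n I B \<beta> \<tau> S) id
        (Comp (module_category A) Q R S \<psi> \<phi>)
      = Comp (lie_module_category ring_of_type_algebra g)
        (tensor_lie_module n e g I f B \<beta> \<tau> U Q) (tensor_lie_module n e g I f B \<beta> \<tau> U R)
        (tensor_lie_module n e g I f B \<beta> \<tau> U S)
        (tensor_map U (underlying_space n I B \<beta> \<tau> R) U (underlying_space n I B \<beta> \<tau> S) id \<psi>)
        (tensor_map U (underlying_space n I B \<beta> \<tau> Q) U (underlying_space n I B \<beta> \<tau> R) id \<phi>)"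
    using tensor_map_compose[OF U.M.module_morphism_id underlying_morphism[OF \<phi>]
        U.M.module_morphism_id underlying_morphism[OF \<psi>]]
    by (simp add: defs compose_eq)
qed

lemma tensor_functor_left:
  fixes V :: "(('i, 'k) mpolynomial set, 'v) module"
  assumes V: "module A V"
  shows "category_functor
    (lie_module_category ring_of_type_algebra h :: (('k, 'h, 'y) lie_module, 'y \<Rightarrow> 'y) category)
    (lie_module_category ring_of_type_algebra g)
    (\<lambda>Y. tensor_lie_module n e g I f B \<beta> \<tau> Y V)
    (\<lambda>Y Y' \<phi>. tensor_map Y (underlying_space n I B \<beta> \<tau> V) Y' (underlying_space n I B \<beta> \<tau> V) \<phi> id)"
proof (intro category_functor.intro lie_module_category_category category_functor_axioms.intro)
  interpret V: universal_module n I B \<beta> \<tau> V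
    by (intro universal_module.intro universal_algebra_data_axioms V)
  have action: "tensor_action n I B \<beta> \<tau> g h f e Q V" if "lie_module ring_of_type_algebra h Q" for Q
    using that by (intro tensor_action.intro lie_algebra_pair_axioms V.universal_module_axioms)
  \<comment> \<open>This identity is linear over the universal algebra, as equivariance requires;
    the composition law uses the one on the underlying vector space.\<close>
  note id = V.W.module_morphism_id
  note defs = lie_module_category_def
  fix Q :: "('k, 'h, 'y) lie_module"
  assume "Q \<in> Obj (lie_module_category ring_of_type_algebra h)"
  then have Q: "lie_module ring_of_type_algebra h Q" by (simp add: defs)
  interpret Q: tensor_action n I B \<beta> \<tau> g h f e Q V by (rule action[OF Q])
  show "tensor_lie_module n e g I f B \<beta> \<tau> Q V \<in> Obj (lie_module_category ring_of_type_algebra g)"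
    by (simp add: defs Q.TL_lie_module)
  show "tensor_map Q V.W\<^sub>k Q V.W\<^sub>k (Ident (lie_module_category ring_of_type_algebra h) Q) id
      = Ident (lie_module_category ring_of_type_algebra g) Q.TL"
    by (simp add: defs tensor_map_ident Q.Y.M.module_axioms V.W\<^sub>k.module_axioms)
  fix R \<phi>
  assume "R \<in> Obj (lie_module_category ring_of_type_algebra h)"
    and \<phi>_hom: "\<phi> \<in> Hom (lie_module_category ring_of_type_algebra h) Q R"
  then have R: "lie_module ring_of_type_algebra h R" by (simp add: defs)
  interpret R: lie_module ring_of_type_algebra h R by (rule R)
  have \<phi>: "module_morphism ring_of_type_algebra Q R \<phi>"
    and \<phi>_act: "\<And>z l. \<lbrakk>z \<in> carrier h; l \<in> carrier Q\<rbrakk> \<Longrightarrow> \<phi> (act Q z l) = act R z (\<phi> l)"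
    using \<phi>_hom linear_maps_iff[OF Q.Y.M.module_axioms R.M.module_axioms]
    by (auto simp: defs lie_module_maps_def)
  show "tensor_map Q V.W\<^sub>k R V.W\<^sub>k \<phi> id
      \<in> Hom (lie_module_category ring_of_type_algebra g)
        (tensor_lie_module n e g I f B \<beta> \<tau> Q V) (tensor_lie_module n e g I f B \<beta> \<tau> R V)"
    using tensor_map_lie_module_map[OF Q R V V \<phi> \<phi>_act id] by (simp add: defs)
  fix S \<psi>
  assume "S \<in> Obj (lie_module_category ring_of_type_algebra h)"
    and \<psi>_hom: "\<psi> \<in> Hom (lie_module_category ring_of_type_algebra h) R S"
  then have "lie_module ring_of_type_algebra h S" by (simp add: defs)
  then interpret S: lie_module ring_of_type_algebra h S .
  have \<psi>: "module_morphism ring_of_type_algebra R S \<psi>"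
    using \<psi>_hom linear_maps_iff[OF R.M.module_axioms S.M.module_axioms]
    by (auto simp: defs lie_module_maps_def)
  show "tensor_map Q V.W\<^sub>k S V.W\<^sub>k (Comp (lie_module_category ring_of_type_algebra h) Q R S \<psi> \<phi>) id
      = Comp (lie_module_category ring_of_type_algebra g)
        (tensor_lie_module n e g I f B \<beta> \<tau> Q V) (tensor_lie_module n e g I f B \<beta> \<tau> R V)
        (tensor_lie_module n e g I f B \<beta> \<tau> S V)
        (tensor_map R V.W\<^sub>k S V.W\<^sub>k \<psi> id) (tensor_map Q V.W\<^sub>k R V.W\<^sub>k \<phi> id)"
    using tensor_map_compose[OF \<phi> V.W\<^sub>k.module_morphism_id \<psi> V.W\<^sub>k.module_morphism_id]
    by (simp add: defs compose_eq)
qed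

end

theorem proposition3p1:
  fixes g :: "('k::field, 'g) lie_algebra" and h :: "('k, 'h) lie_algebra"
    and I :: "'i set" and f :: "'i \<Rightarrow> 'g"
    and n :: nat and e :: "nat \<Rightarrow> 'h"
    and B :: "'i \<Rightarrow> 'i \<Rightarrow> 'i set" and \<beta> :: "'i \<Rightarrow> 'i \<Rightarrow> 'i \<Rightarrow> 'k"
    and \<tau> :: "nat \<Rightarrow> nat \<Rightarrow> nat \<Rightarrow> 'k"
    and U :: "('k, 'h, 'u) lie_module"
    and V :: "(('i, 'k) mpolynomial set, 'v) module"
  assumes "lie_algebra ring_of_type_algebra g" and "lie_algebra ring_of_type_algebra h"
    and "is_basis g I f" and "is_basis h {1..n} e"
    and "\<And>i j. \<lbrakk>i \<in> {1..n}; j \<in> {1..n}\<rbrakk>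
      \<Longrightarrow> bracket h (e i) (e j) = (\<Oplus>\<^bsub>h\<^esub>s\<in>{1..n}. \<tau> i j s \<odot>\<^bsub>h\<^esub> e s)"
    and "\<And>i j. \<lbrakk>i \<in> I; j \<in> I\<rbrakk> \<Longrightarrow> finite (B i j) \<and> B i j \<subseteq> I"
    and "\<And>i j. \<lbrakk>i \<in> I; j \<in> I\<rbrakk>
      \<Longrightarrow> bracket g (f i) (f j) = (\<Oplus>\<^bsub>g\<^esub>u\<in>B i j. \<beta> i j u \<odot>\<^bsub>g\<^esub> f u)"
    and "lie_module ring_of_type_algebra h U"
    and "module (universal_algebra n I B \<beta> \<tau>) V"
  shows
    "category_functor
       (module_category (universal_algebra n I B \<beta> \<tau>) ::
         ((('i, 'k) mpolynomial set, 'x) module, 'x \<Rightarrow> 'x) category)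
       (lie_module_category ring_of_type_algebra g)
       (\<lambda>W. tensor_lie_module n e g I f B \<beta> \<tau> U W)
       (\<lambda>W W' \<phi>. tensor_map U (underlying_space n I B \<beta> \<tau> W)
                            U (underlying_space n I B \<beta> \<tau> W') id \<phi>)
     \<and> category_functor
       (lie_module_category ring_of_type_algebra h ::
         (('k, 'h, 'y) lie_module, 'y \<Rightarrow> 'y) category)
       (lie_module_category ring_of_type_algebra g)
       (\<lambda>Y. tensor_lie_module n e g I f B \<beta> \<tau> Y V)
       (\<lambda>Y Y' \<phi>. tensor_map Y (underlying_space n I B \<beta> \<tau> V)
                            Y' (underlying_space n I B \<beta> \<tau> V) \<phi> id)
     \<and> (\<forall>(Y :: ('k, 'h, 'y) lie_module) (W :: (('i, 'k) mpolynomial set, 'x) module).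
         lie_module ring_of_type_algebra h Y \<longrightarrow> module (universal_algebra n I B \<beta> \<tau>) W \<longrightarrow>
         (\<forall>i\<in>I. \<forall>l\<in>carrier Y. \<forall>t\<in>carrier W.
           act (tensor_lie_module n e g I f B \<beta> \<tau> Y W) (f i)
               (pure_tensor Y (underlying_space n I B \<beta> \<tau> W) l t) =
           (\<Oplus>\<^bsub>tensor_lie_module n e g I f B \<beta> \<tau> Y W\<^esub>j\<in>{1..n}.
              pure_tensor Y (underlying_space n I B \<beta> \<tau> W)
                (act Y (e j) l) (universal_gen n I B \<beta> \<tau> j i \<odot>\<^bsub>W\<^esub> t))))"
proof -
  interpret lie_algebra_pair n I B \<beta> \<tau> g h f e
    using assms by (intro lie_algebra_pair.intro universal_algebra_data.intro lie_algebra_pair_axioms.intro)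
  show ?thesis
  proof (intro conjI allI impI ballI)
    fix Y :: "('k, 'h, 'y) lie_module" and W :: "(('i, 'k) mpolynomial set, 'x) module" and i l t
    assume "lie_module ring_of_type_algebra h Y" "module A W"
    then interpret tensor_action n I B \<beta> \<tau> g h f e Y W
      by (intro tensor_action.intro universal_module.intro lie_algebra_pair_axioms
          universal_algebra_data_axioms)
    assume "i \<in> I" "l \<in> carrier Y" "t \<in> carrier W"
    then show "act TL (f i) (pure l t)
        = (\<Oplus>\<^bsub>TL\<^esub>j\<in>{1..n}. pure (act Y (e j) l) (x j i \<odot>\<^bsub>W\<^esub> t))"
      using pure_closed by (simp add: TL_act_basis D_pure del: One_nat_def)
  qed (rule tensor_functor_right[OF assms(8)], rule tensor_functor_left[OF assms(9)])
qed

end
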